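(* For each positive integer $n$, let $\mu_n$ be a probability measure on $\Xi_n=\{-1,+1\}^{V_n}$. Assume that the following hypotheses hold. (1) Let $r$ be any fixed integer. For any local configuration $\zeta_{D,0}$ on the ball $B(0,r)$, let $\zeta_{D,x}$ be the local configuration on $B(x,r)$ defined by $\zeta_{D,x}(x+y)=\zeta_{D,0}(y)$ for all $y\in B(0,r)$. Assume there exists $p_D>0$ such that $$\forall n>2\rho r,\ \forall x\in V_n,\qquad \mu_n\big(\eta_{B(x,r)}\equiv \zeta_{D,x}\big)\ \ge\ p_D .$$ (2) Assume there exist a function $\psi$ from $\mathbb{N}\times\mathbb{N}$ into $\mathbb{R}$ and a function $\epsilon$ from $\mathbb{N}$ to $\mathbb{R}$, decreasing to $0$, such that if $B$, $C$ are disjoint subsets of $V_n$, and $e_B$, $e_C$ are local events relative to $B$ and $C$ respectively, then $$|\mu_n(e_B\cap e_C)-\mu_n(e_B)\mu_n(e_C)|\ \le\ \psi(|B|,|C|)\,\epsilon(dist(B,C)).$$ Then for any first-order sentence $A$, $$\lim_{n\to\infty}\mu_n(A)=0 \text{ or } 1,$$ where $\mu_n(A)$ denotes $\mu_n(\{\eta\in\Xi_n:\eta\models A\})$.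
   Context: Lattice torus. Fix a dimension $d$, $p$ with $1\le p\le\infty$, and a parameter $\rho$. For each $n$, $V_n=\{0,\ldots,n-1\}^d$, with all operations on vertices taken componentwise modulo $n$ (periodic boundary conditions). $G_n=(V_n,E_n)$ is the undirected graph in which the neighbors of $x$ are the $y\ne x$ in $V_n$ with $\|y-x\|_p\le\rho$, where the subtraction is taken componentwise modulo $n$ and $\|\cdot\|_p$ is the $L_p$ norm on $\mathbb{R}^d$. $dist$ is the graph distance in $G_n$, $dist(B,C)=\min\{dist(x,y): x\in B,\ y\in C\}$ for vertex subsets $B,C$, and $B(x,r)=\{y\in V_n: dist(x,y)\le r\}$. For $n>2\rho r$ the balls of radius $r$ are translates of each other, $B(x+y,r)=y+B(x,r)$, and balls of radius $r$ for different such $n$ are isomorphic, so that a local configuration on $B(0,r)$ (a map $B(0,r)\to\{-1,+1\}$) is regarded as not depending on $n$. $|B|$ denotes cardinality. Configurations. An element $\eta$ of $\Xi_n=\{-1,+1\}^{V_n}$ is a configuration; $\eta_B$ is its restriction to $B\subset V_n$. A local event relative to $B$ is an event which depends only on the values of $\eta(x)$ for $x\in B$. Logic. The vocabulary consists of one unary predicate $C$ and some binary predicates, applied to the domain $V_n$. In all structures considered, the list of facts relative to the binary predicates is fixed, so that the associated graph, which joins those pairs $\{x,y\}$ such that $Rxy$ or $Ryx$ holds for some binary predicate $R$, is the lattice torus $G_n$. Structures thus differ only by their unary facts, and a structure is identified with the configuration $\eta$ such that $\eta(x)=+1$ if $Cx$ holds and $\eta(x)=-1$ if $\neg Cx$ holds.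 First-order formulas are obtained from atoms ($Cx$, $Rxy$, etc.) by negation, conjunction and quantification over variables in the domain; a sentence is a formula all of whose variables are quantified. $\eta\models A$ means that the structure identified with $\eta$ satisfies $A$.
   Formalization: The fixed binary facts are taken translation invariant: each binary predicate holds of x,y iff y−x mod n lies in a displacement set independent of x and n; otherwise the claim fails, e.g. for a predicate empty for even n and equal to adjacency for odd n. *)

theory Defs
  imports
    "HOL-Probability.Probability"
    "HOL-Library.Centered_Division"
begin

section \<open>Graph distance\<close>

text \<open>A graph is given by its set of ordered pairs of neighbours. The distance is the least length of
  a walk, and \<open>\<infinity>\<close> between different connected components. A walk of length \<open>k\<close> from \<open>x\<close> to \<open>y\<close> exists
  iff \<open>(x, y) \<in> E ^^ k\<close>.\<close>

definition graph_dist :: "('v \<times> 'v) set \<Rightarrow> 'v \<Rightarrow> 'v \<Rightarrow> enat" where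
  "graph_dist E x y = (INF k\<in>{k. (x, y) \<in> E ^^ k}. enat k)"

definition set_dist :: "('v \<times> 'v) set \<Rightarrow> 'v set \<Rightarrow> 'v set \<Rightarrow> enat" where
  "set_dist E B C = (INF x\<in>B. INF y\<in>C. graph_dist E x y)"

definition graph_ball :: "('v \<times> 'v) set \<Rightarrow> 'v \<Rightarrow> nat \<Rightarrow> 'v set" where
  "graph_ball E x r = {y. graph_dist E x y \<le> enat r}"


section \<open>The lattice torus\<close>

text \<open>The dimension is \<open>d = CARD('d)\<close>, hence \<open>d \<ge> 1\<close>.\<close>

definition lp_norm :: "ennreal \<Rightarrow> real ^ 'd::finite \<Rightarrow> real" where
  "lp_norm p x =
     (if p = \<infinity> then infnorm x
      else (\<Sum>i\<in>UNIV. \<bar>x $ i\<bar> powr enn2real p) powr (1 / enn2real p))"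

definition real_vec :: "int ^ 'd \<Rightarrow> real ^ 'd::finite" where
  "real_vec z = (\<chi> i. real_of_int (z $ i))"

definition torus :: "nat \<Rightarrow> (int ^ 'd::finite) set" where
  "torus n = {x. \<forall>i. 0 \<le> x $ i \<and> x $ i < int n}"

definition wrap :: "nat \<Rightarrow> int ^ 'd \<Rightarrow> int ^ 'd::finite" where
  "wrap n x = (\<chi> i. x $ i mod int n)"

text \<open>The norm of a difference modulo \<open>n\<close> is taken at the representative whose coordinates have
  least absolute value; with the representative in \<open>{0..<n}\<close> the neighbour relation would not be
  symmetric. When \<open>n\<close> is even, the coordinate \<open>n / 2\<close> is represented by \<open>- n / 2\<close>, which does not
  affect the norm.\<close>

definition centered :: "nat \<Rightarrow> int ^ 'd \<Rightarrow> int ^ 'd::finite" where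
  "centered n x = (\<chi> i. x $ i cmod int n)"

definition torus_edges :: "ennreal \<Rightarrow> real \<Rightarrow> nat \<Rightarrow> ((int ^ 'd) \<times> (int ^ 'd::finite)) set" where
  "torus_edges p \<rho> n =
     {(x, y). x \<in> torus n \<and> y \<in> torus n \<and> y \<noteq> x \<and> lp_norm p (real_vec (centered n (y - x))) \<le> \<rho>}"

text \<open>The same graph on the infinite lattice. For \<open>n > 2 * \<rho> * r\<close> its ball of radius \<open>r\<close> around \<open>0\<close>
  is identified with any ball of radius \<open>r\<close> of the torus, see \<open>bij_betw_lattice_ball\<close> below. It serves
  as the domain, common to all these \<open>n\<close>, of the local configurations.\<close>

definition lattice_edges :: "ennreal \<Rightarrow> real \<Rightarrow> ((int ^ 'd) \<times> (int ^ 'd::finite)) set" where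
  "lattice_edges p \<rho> = {(x, y). y \<noteq> x \<and> lp_norm p (real_vec (y - x)) \<le> \<rho>}"

definition lattice_ball :: "ennreal \<Rightarrow> real \<Rightarrow> nat \<Rightarrow> (int ^ 'd::finite) set" where
  "lattice_ball p \<rho> r = graph_ball (lattice_edges p \<rho>) 0 r"


section \<open>Configurations\<close>

definition configs :: "nat \<Rightarrow> (int ^ 'd::finite \<Rightarrow> int) set" where
  "configs n = torus n \<rightarrow>\<^sub>E {-1, 1}"

definition local_event ::
  "nat \<Rightarrow> (int ^ 'd) set \<Rightarrow> (int ^ 'd::finite \<Rightarrow> int) set \<Rightarrow> bool" where
  "local_event n B e \<longleftrightarrow>
     e \<subseteq> configs n \<and>
     (\<forall>\<eta>\<in>configs n. \<forall>\<eta>'\<in>configs n. (\<forall>x\<in>B. \<eta> x = \<eta>' x) \<longrightarrow> (\<eta> \<in> e \<longleftrightarrow> \<eta>' \<in> e))"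

definition local_configs :: "ennreal \<Rightarrow> real \<Rightarrow> nat \<Rightarrow> (int ^ 'd::finite \<Rightarrow> int) set" where
  "local_configs p \<rho> r = lattice_ball p \<rho> r \<rightarrow>\<^sub>E {-1, 1}"

text \<open>The event that \<open>\<eta>\<close> agrees on the ball of radius \<open>r\<close> around \<open>x\<close> with the translate to \<open>x\<close> of the
  local configuration \<open>\<zeta>\<close>.\<close>

definition pattern_event ::
  "ennreal \<Rightarrow> real \<Rightarrow> nat \<Rightarrow> nat \<Rightarrow> (int ^ 'd \<Rightarrow> int) \<Rightarrow> int ^ 'd \<Rightarrow> (int ^ 'd::finite \<Rightarrow> int) set" where
  "pattern_event p \<rho> n r \<zeta> x =
     {\<eta> \<in> configs n. \<forall>y\<in>lattice_ball p \<rho> r. \<eta> (wrap n (x + y)) = \<zeta> y}"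

text \<open>A mixing rate extended by its limit \<open>0\<close> to infinite distance. This only matters when \<open>B\<close> or \<open>C\<close>
  is empty, or when the torus is disconnected (\<open>\<rho> < 1\<close>, no edges).\<close>

definition rate_at :: "(nat \<Rightarrow> real) \<Rightarrow> enat \<Rightarrow> real" where
  "rate_at \<epsilon> k = (case k of enat m \<Rightarrow> \<epsilon> m | \<infinity> \<Rightarrow> 0)"


section \<open>First-order logic\<close>

text \<open>One unary predicate \<open>C\<close> and binary predicates with symbols in \<open>'r\<close>; variables are natural
  numbers.\<close>

datatype 'r formula =
    Unary nat
  | Binary 'r nat nat
  | Equal nat nat
  | Neg "'r formula"
  | Conj "'r formula" "'r formula"
  | Forall nat "'r formula"
  | Exists nat "'r formula"

primrec free_vars :: "'r formula \<Rightarrow> nat set" where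
  "free_vars (Unary i) = {i}"
| "free_vars (Binary R i j) = {i, j}"
| "free_vars (Equal i j) = {i, j}"
| "free_vars (Neg A) = free_vars A"
| "free_vars (Conj A B) = free_vars A \<union> free_vars B"
| "free_vars (Forall i A) = free_vars A - {i}"
| "free_vars (Exists i A) = free_vars A - {i}"

definition sentence :: "'r formula \<Rightarrow> bool" where
  "sentence A \<longleftrightarrow> free_vars A = {}"

text \<open>\<open>sat V C I s A\<close>: the formula \<open>A\<close> holds under the assignment \<open>s\<close> in the structure with domain
  \<open>V\<close>, unary predicate \<open>C\<close> and interpretation \<open>I\<close> of the binary predicates.\<close>

primrec sat ::
  "'v set \<Rightarrow> 'v set \<Rightarrow> ('r \<Rightarrow> ('v \<times> 'v) set) \<Rightarrow> (nat \<Rightarrow> 'v) \<Rightarrow> 'r formula \<Rightarrow> bool" where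
  "sat V C I s (Unary i) \<longleftrightarrow> s i \<in> C"
| "sat V C I s (Binary R i j) \<longleftrightarrow> (s i, s j) \<in> I R"
| "sat V C I s (Equal i j) \<longleftrightarrow> s i = s j"
| "sat V C I s (Neg A) \<longleftrightarrow> \<not> sat V C I s A"
| "sat V C I s (Conj A B) \<longleftrightarrow> sat V C I s A \<and> sat V C I s B"
| "sat V C I s (Forall i A) \<longleftrightarrow> (\<forall>v\<in>V. sat V C I (s(i := v)) A)"
| "sat V C I s (Exists i A) \<longleftrightarrow> (\<exists>v\<in>V. sat V C I (s(i := v)) A)"

definition models ::
  "nat \<Rightarrow> ('r \<Rightarrow> ((int ^ 'd) \<times> (int ^ 'd)) set) \<Rightarrow> (int ^ 'd::finite \<Rightarrow> int) \<Rightarrow> 'r formula \<Rightarrow> bool" where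
  "models n I \<eta> A \<longleftrightarrow>
     (\<forall>s. range s \<subseteq> torus n \<longrightarrow> sat (torus n) {x \<in> torus n. \<eta> x = 1} I s A)"

definition associated_graph ::
  "'v set \<Rightarrow> ('r \<Rightarrow> ('v \<times> 'v) set) \<Rightarrow> ('v \<times> 'v) set" where
  "associated_graph V I =
     {(x, y). x \<in> V \<and> y \<in> V \<and> x \<noteq> y \<and> (\<exists>R. (x, y) \<in> I R \<or> (y, x) \<in> I R)}"

text \<open>The binary facts are fixed: the predicate \<open>R\<close> holds between \<open>x\<close> and \<open>y\<close> iff \<open>y - x\<close> is, modulo
  \<open>n\<close>, one of the displacements in \<open>S R\<close>, a set which depends neither on \<open>x\<close> nor on \<open>n\<close>. For instance,
  \<open>S R\<close> consists of all nonzero vectors of norm at most \<open>\<rho>\<close> when \<open>R\<close> is the neighbour relation, and of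
  a single unit vector when \<open>R\<close> is the successor relation in a coordinate direction. If the binary
  facts could vary with \<open>n\<close> beyond this, the probability that some binary fact \<open>R x y\<close> holds could
  alternate between \<open>0\<close> and \<open>1\<close> even when the associated graph is always the torus.\<close>

definition torus_relation ::
  "nat \<Rightarrow> ('r \<Rightarrow> (int ^ 'd) set) \<Rightarrow> 'r \<Rightarrow> ((int ^ 'd) \<times> (int ^ 'd::finite)) set" where
  "torus_relation n S R =
     {(x, y). x \<in> torus n \<and> y \<in> torus n \<and> (\<exists>z\<in>S R. y = wrap n (x + z))}"


section \<open>Identification of the balls\<close>

lemma graph_ball_iff: "y \<in> graph_ball E x r \<longleftrightarrow> (\<exists>k\<le>r. (x, y) \<in> E ^^ k)"
proof
  assume "y \<in> graph_ball E x r"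
  then have le: "(INF k\<in>{k. (x, y) \<in> E ^^ k}. enat k) \<le> enat r"
    by (simp add: graph_ball_def graph_dist_def)
  show "\<exists>k\<le>r. (x, y) \<in> E ^^ k"
  proof (rule ccontr)
    assume "\<not> ?thesis"
    then have "enat (Suc r) \<le> (INF k\<in>{k. (x, y) \<in> E ^^ k}. enat k)"
      by (intro INF_greatest) (auto simp: not_less_eq_eq[symmetric])
    from order_trans[OF this le] show False by simp
  qed
next
  assume "\<exists>k\<le>r. (x, y) \<in> E ^^ k"
  then show "y \<in> graph_ball E x r"
    by (auto simp: graph_ball_def graph_dist_def intro: INF_lower2)
qed

lemma enn2real_ge_1: "1 \<le> p \<Longrightarrow> p \<noteq> \<infinity> \<Longrightarrow> 1 \<le> enn2real p"
  by (metis enn2real_1 enn2real_mono infinity_ennreal_def less_top)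

lemma component_le_lp_norm:
  fixes x :: "real ^ 'd::finite"
  assumes "1 \<le> p"
  shows "\<bar>x $ i\<bar> \<le> lp_norm p x"
proof (cases "p = \<infinity>")
  case True
  then show ?thesis by (simp add: lp_norm_def component_le_infnorm_cart)
next
  case False
  define q where "q = enn2real p"
  have q: "1 \<le> q" using enn2real_ge_1[OF assms False] by (simp add: q_def)
  have "\<bar>x $ i\<bar> = (\<bar>x $ i\<bar> powr q) powr (1 / q)"
    using q by (simp add: powr_powr)
  also have "\<dots> \<le> (\<Sum>i\<in>UNIV. \<bar>x $ i\<bar> powr q) powr (1 / q)"
    using q by (intro powr_mono2 member_le_sum) auto
  finally show ?thesis using False by (simp add: lp_norm_def q_def)
qed

lemma lp_norm_mono:
  fixes x y :: "real ^ 'd::finite"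
  assumes "1 \<le> p" "\<And>i. \<bar>x $ i\<bar> \<le> \<bar>y $ i\<bar>"
  shows "lp_norm p x \<le> lp_norm p y"
proof (cases "p = \<infinity>")
  case True
  have "infnorm x \<le> infnorm y"
    unfolding infnorm_cart[of x]
    by (rule cSup_least) (use assms(2) component_le_infnorm_cart[of y] order_trans in blast)+
  with True show ?thesis by (simp add: lp_norm_def)
next
  case False
  then show ?thesis using enn2real_ge_1[OF assms(1) False] assms(2)
    by (auto simp: lp_norm_def intro!: powr_mono2 sum_mono sum_nonneg)
qed

lemma cmod_abs_le: "\<bar>k cmod int n\<bar> \<le> \<bar>k\<bar>"
proof (cases "n = 0")
  case False
  define a where "a = (k + int n div 2) mod int n"
  define b where "b = (k + int n div 2) div int n"
  have k: "k + int n div 2 = int n * b + a" by (simp add: a_def b_def)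
  have a: "0 \<le> a" "a < int n" using False by (auto simp: a_def)
  have c: "k cmod int n = a - int n div 2" by (simp add: centered_modulo_def a_def)
  consider "b = 0" | "b \<ge> 1" | "b \<le> -1" by linarith
  then show ?thesis
  proof cases
    case 2
    then have "int n * b \<ge> int n" using mult_left_mono[of 1 b "int n"] by simp
    then show ?thesis using k a c by linarith
  next
    case 3
    then have "int n * b \<le> - int n" using mult_left_mono[of b "-1" "int n"] by simp
    then show ?thesis using k a c by linarith
  qed (use k c in auto)
qed simp

lemma cmod_cong_mod: "(k cmod m) mod m = k mod (m :: int)"
  by (metis minus_mult_cdiv_eq_cmod mod_diff_right_eq mod_mult_self1_is_0 diff_zero)

lemma cmod_mod: "(k mod m) cmod m = k cmod (m :: int)" if "0 \<le> m"
  using that by (simp add: centered_modulo_def mod_add_left_eq)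

lemma wrap_add_centered: "wrap n (x + centered n y) = wrap n (x + y)"
  by (simp add: wrap_def centered_def vec_eq_iff) (metis cmod_cong_mod mod_add_right_eq)

lemma wrap_eq_self: "x \<in> torus n \<Longrightarrow> wrap n x = x"
  by (simp add: wrap_def torus_def vec_eq_iff)

lemma wrap_in_torus: "n > 0 \<Longrightarrow> wrap n x \<in> torus n"
  by (simp add: wrap_def torus_def)

lemma centered_wrap_diff: "centered n (wrap n y - wrap n x) = centered n (y - x)"
proof -
  have "(y $ i mod int n - x $ i mod int n) cmod int n = (y $ i - x $ i) cmod int n" for i
    by (metis cmod_mod mod_diff_eq of_nat_0_le_iff)
  then show ?thesis by (simp add: centered_def wrap_def vec_eq_iff)
qed

lemma lattice_walk_to_torus:
  fixes x y :: "int ^ 'd::finite"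
  assumes "1 \<le> p" "n > 0" "(x, y) \<in> lattice_edges p \<rho> ^^ k"
  shows "\<exists>j\<le>k. (wrap n x, wrap n y) \<in> torus_edges p \<rho> n ^^ j"
  using assms(3)
proof (induction k arbitrary: y)
  case (Suc k)
  then obtain z where z: "(x, z) \<in> lattice_edges p \<rho> ^^ k" "(z, y) \<in> lattice_edges p \<rho>"
    by auto
  from Suc.IH[OF z(1)] obtain j
    where j: "j \<le> k" "(wrap n x, wrap n z) \<in> torus_edges p \<rho> n ^^ j" by blast
  show ?case
  proof (cases "wrap n y = wrap n z")
    case True
    with j show ?thesis by (auto intro!: exI[of _ j])
  next
    case False
    have "lp_norm p (real_vec (centered n (y - z))) \<le> lp_norm p (real_vec (y - z))"
      using cmod_abs_le[of _ n]
      by (intro lp_norm_mono[OF assms(1)]) (simp add: real_vec_def centered_def flip: of_int_diff of_int_abs)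
    also have "\<dots> \<le> \<rho>" using z(2) by (simp add: lattice_edges_def)
    finally have "(wrap n z, wrap n y) \<in> torus_edges p \<rho> n"
      using False assms(2) by (simp add: torus_edges_def wrap_in_torus centered_wrap_diff)
    with j show ?thesis by (intro exI[of _ "Suc j"]) auto
  qed
qed (auto intro: exI[of _ 0])

lemma torus_walk_to_lattice:
  fixes x v :: "int ^ 'd::finite"
  assumes "n > 0" "x \<in> torus n" "(x, v) \<in> torus_edges p \<rho> n ^^ k"
  shows "\<exists>y. wrap n (x + y) = v \<and> (0, y) \<in> lattice_edges p \<rho> ^^ k"
  using assms(3)
proof (induction k arbitrary: v)
  case 0
  with assms show ?case by (auto simp: wrap_eq_self)
next
  case (Suc k)
  then obtain u where u: "(x, u) \<in> torus_edges p \<rho> n ^^ k" "(u, v) \<in> torus_edges p \<rho> n"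
    by auto
  from Suc.IH[OF u(1)] obtain y
    where y: "wrap n (x + y) = u" "(0, y) \<in> lattice_edges p \<rho> ^^ k" by blast
  define z where "z = centered n (v - u)"
  have uv: "u \<in> torus n" "v \<in> torus n" "v \<noteq> u" "lp_norm p (real_vec z) \<le> \<rho>"
    using u(2) by (auto simp: torus_edges_def z_def)
  have "wrap n (x + y + z) = wrap n (wrap n (x + y) + z)"
    by (simp add: wrap_def vec_eq_iff mod_add_left_eq)
  also have "\<dots> = v"
    using uv(2) by (simp add: y(1) z_def wrap_add_centered wrap_eq_self)
  finally have w: "wrap n (x + (y + z)) = v" by (simp add: add.assoc)
  have "z \<noteq> 0" using w y(1) uv(3) by auto
  then have "(y, y + z) \<in> lattice_edges p \<rho>" using uv(4) by (simp add: lattice_edges_def)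
  with y(2) w show ?case by auto
qed

lemma lattice_walk_component:
  fixes y :: "int ^ 'd::finite"
  assumes "1 \<le> p" "(0, y) \<in> lattice_edges p \<rho> ^^ k"
  shows "real_of_int \<bar>y $ i\<bar> \<le> \<rho> * k"
  using assms(2)
proof (induction k arbitrary: y)
  case (Suc k)
  then obtain z where z: "(0, z) \<in> lattice_edges p \<rho> ^^ k" "(z, y) \<in> lattice_edges p \<rho>"
    by auto
  have "real_of_int \<bar>(y - z) $ i\<bar> \<le> \<rho>"
    using component_le_lp_norm[OF assms(1), of "real_vec (y - z)" i] z(2)
    by (simp add: lattice_edges_def real_vec_def)
  then show ?case using Suc.IH[OF z(1)] by (simp add: algebra_simps)
qed simp

theorem bij_betw_lattice_ball:
  fixes x :: "int ^ 'd::finite"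
  assumes p: "1 \<le> p" and n: "n > 0" "real n > 2 * \<rho> * real r" and x: "x \<in> torus n"
  shows "bij_betw (\<lambda>y. wrap n (x + y)) (lattice_ball p \<rho> r) (graph_ball (torus_edges p \<rho> n) x r)"
  unfolding bij_betw_def
proof
  have small: "2 * real_of_int \<bar>y $ i\<bar> < real n"
    if y: "y \<in> lattice_ball p \<rho> r" for y :: "int ^ 'd" and i
  proof -
    from y obtain k where k: "k \<le> r" "(0, y) \<in> lattice_edges p \<rho> ^^ k"
      by (auto simp: lattice_ball_def graph_ball_iff)
    have le: "real_of_int \<bar>y $ i\<bar> \<le> \<rho> * k" by (rule lattice_walk_component[OF p k(2)])
    show ?thesis
    proof (cases "\<rho> \<ge> 0")
      case True
      then have "\<rho> * k \<le> \<rho> * r" using k(1) by (intro mult_left_mono) auto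
      with le n show ?thesis by simp
    next
      case False
      then have "\<rho> * k \<le> 0" by (intro mult_nonpos_nonneg) auto
      with le n show ?thesis by simp
    qed
  qed
  show "inj_on (\<lambda>y. wrap n (x + y)) (lattice_ball p \<rho> r)"
  proof (rule inj_onI)
    fix y z :: "int ^ 'd"
    assume yz: "y \<in> lattice_ball p \<rho> r" "z \<in> lattice_ball p \<rho> r"
      and eq: "wrap n (x + y) = wrap n (x + z)"
    have "y $ i = z $ i" for i
    proof -
      have "(x $ i + y $ i) mod int n = (x $ i + z $ i) mod int n"
        using eq by (simp add: wrap_def vec_eq_iff)
      then have dv: "int n dvd y $ i - z $ i" by (simp add: mod_eq_dvd_iff)
      have "\<bar>y $ i - z $ i\<bar> < int n"
        using small[OF yz(1), of i] small[OF yz(2), of i] by linarith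
      with dv show ?thesis using zdvd_imp_le[of "int n" "\<bar>y $ i - z $ i\<bar>"] by fastforce
    qed
    then show "y = z" by (simp add: vec_eq_iff)
  qed
  show "(\<lambda>y. wrap n (x + y)) ` lattice_ball p \<rho> r = graph_ball (torus_edges p \<rho> n) x r"
  proof (intro equalityI subsetI)
    fix v assume "v \<in> (\<lambda>y. wrap n (x + y)) ` lattice_ball p \<rho> r"
    then obtain y k where y: "v = wrap n (x + y)" "k \<le> r" "(0, y) \<in> lattice_edges p \<rho> ^^ k"
      by (auto simp: lattice_ball_def graph_ball_iff)
    have "(x + 0, x + y) \<in> lattice_edges p \<rho> ^^ k"
      using y(3)
    proof (induction k arbitrary: y)
      case (Suc k)
      then show ?case by (fastforce simp: lattice_edges_def)
    qed simp
    from lattice_walk_to_torus[OF p n(1) this] y x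
    show "v \<in> graph_ball (torus_edges p \<rho> n) x r"
      by (auto simp: graph_ball_iff wrap_eq_self intro: order_trans)
  next
    fix v assume "v \<in> graph_ball (torus_edges p \<rho> n) x r"
    then obtain k where "k \<le> r" "(x, v) \<in> torus_edges p \<rho> n ^^ k"
      by (auto simp: graph_ball_iff)
    with torus_walk_to_lattice[OF n(1) x this(2)]
    show "v \<in> (\<lambda>y. wrap n (x + y)) ` lattice_ball p \<rho> r"
      by (force simp: lattice_ball_def graph_ball_iff)
  qed
qed

section \<open>Realizing the torus as an associated graph\<close>

lemma wrap_eq_iff: "wrap n x = wrap n y \<longleftrightarrow> (\<forall>i. int n dvd x $ i - y $ i)"
  by (simp add: wrap_def vec_eq_iff mod_eq_dvd_iff)

lemma torus_step_iff:
  assumes "x \<in> torus n" "y \<in> torus n"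
  shows "y = wrap n (x + z) \<longleftrightarrow> wrap n z = wrap n (y - x)"
proof -
  have "y = wrap n (x + z) \<longleftrightarrow> wrap n (x + z) = wrap n y"
    using wrap_eq_self[OF assms(2)] by auto
  also have "\<dots> \<longleftrightarrow> wrap n z = wrap n (y - x)"
    unfolding wrap_eq_iff by (simp add: algebra_simps)
  finally show ?thesis .
qed

theorem associated_graph_torus_relation:
  fixes S :: "'r \<Rightarrow> (int ^ 'd::finite) set"
  assumes p: "1 \<le> p" and n: "n > 0"
    and S: "\<And>z. z \<noteq> 0 \<Longrightarrow> (\<exists>R. z \<in> S R \<or> - z \<in> S R) \<longleftrightarrow> lp_norm p (real_vec z) \<le> \<rho>"
  shows "associated_graph (torus n) (torus_relation n S) = torus_edges p \<rho> n"
proof -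
  have "(\<exists>R. (x, y) \<in> torus_relation n S R \<or> (y, x) \<in> torus_relation n S R) \<longleftrightarrow>
      lp_norm p (real_vec (centered n (y - x))) \<le> \<rho>" (is "?L \<longleftrightarrow> ?R")
    if x: "x \<in> torus n" and y: "y \<in> torus n" and ne: "x \<noteq> y" for x y
  proof -
    have neg: "wrap n z = wrap n (x - y) \<longleftrightarrow> wrap n (- z) = wrap n (y - x)" for z
    proof -
      have "int n dvd z $ i - (x - y) $ i \<longleftrightarrow> int n dvd (- z) $ i - (y - x) $ i" for i
        using dvd_minus_iff[of "int n" "z $ i - (x - y) $ i"] by (simp add: algebra_simps)
      then show ?thesis unfolding wrap_eq_iff by simp
    qed
    have "?L \<longleftrightarrow> (\<exists>R z. z \<in> S R \<and> (wrap n z = wrap n (y - x) \<or> wrap n (- z) = wrap n (y - x)))"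
      using x y by (auto simp: torus_relation_def torus_step_iff neg)
    also have "\<dots> \<longleftrightarrow> (\<exists>z. wrap n z = wrap n (y - x) \<and> (\<exists>R. z \<in> S R \<or> - z \<in> S R))"
      by (metis minus_minus)
    also have "\<dots> \<longleftrightarrow> (\<exists>z. wrap n z = wrap n (y - x) \<and> lp_norm p (real_vec z) \<le> \<rho>)"
    proof -
      have "z \<noteq> 0" if "wrap n z = wrap n (y - x)" for z
        using that torus_step_iff[OF x y, of z] wrap_eq_self[OF x] ne by auto
      with S show ?thesis by blast
    qed
    also have "\<dots> \<longleftrightarrow> ?R"
    proof
      assume "\<exists>z. wrap n z = wrap n (y - x) \<and> lp_norm p (real_vec z) \<le> \<rho>"
      then obtain z where z: "wrap n z = wrap n (y - x)" "lp_norm p (real_vec z) \<le> \<rho>" by blast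
      have "centered n (y - x) = centered n z"
        using centered_wrap_diff[of n z 0] centered_wrap_diff[of n "y - x" 0] z(1) by simp
      moreover have "lp_norm p (real_vec (centered n z)) \<le> lp_norm p (real_vec z)"
        using cmod_abs_le[of _ n]
        by (intro lp_norm_mono[OF p]) (simp add: real_vec_def centered_def flip: of_int_abs)
      ultimately show ?R using z(2) by simp
    next
      assume ?R
      then show "\<exists>z. wrap n z = wrap n (y - x) \<and> lp_norm p (real_vec z) \<le> \<rho>"
        using wrap_add_centered[of n 0 "y - x"] by auto
    qed
    finally show ?thesis .
  qed
  then show ?thesis by (auto simp: associated_graph_def torus_edges_def)
qed

end

theory Submission
  imports Defs
begin

text \<open>Call a configuration rich if every local configuration on the ball of radius \<open>T\<close> occurs in it
  at \<open>m\<close> places at mutual distance more than \<open>2 T\<close>. In an Ehrenfeucht--Fraisse game between two rich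
  configurations, possibly on tori of different sizes, the duplicator copies the displacement when
  the new point is close to an old one; otherwise some occurrence of the neighbourhood of the new point
  is far from all the old ones. As the radius in question doubles with each quantifier, \<open>T\<close> and \<open>m\<close>
  can be chosen such that a given sentence holds in all rich configurations on large tori or in none.

  It remains to see that almost all configurations are rich. By mixing, the probability that a local
  configuration occurs at none of \<open>k\<close> centres far from each other is at most \<open>(1 - q) ^ k\<close> up to a
  small error. Applying this to \<open>m\<close> disjoint groups of \<open>k\<close> centres gives \<open>m\<close> occurrences.\<close>

section \<open>Displacements on the torus\<close>

lemma wrap_wrap_add: "wrap n (wrap n x + z) = wrap n (x + z)"
  by (simp add: wrap_def vec_eq_iff mod_add_left_eq)

lemma wrap_add_eq_iff:
  assumes "x \<in> torus n" "y \<in> torus n"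
  shows "y = wrap n (x + z) \<longleftrightarrow> x = wrap n (y + - z)"
proof
  assume y: "y = wrap n (x + z)"
  show "x = wrap n (y + - z)"
    unfolding y wrap_wrap_add using assms by (simp add: wrap_eq_self)
next
  assume x: "x = wrap n (y + - z)"
  show "y = wrap n (x + z)"
    unfolding x wrap_wrap_add using assms by (simp add: wrap_eq_self)
qed

lemma wrap_eq_imp_eq:
  assumes "wrap n a = wrap n b" "\<And>i. \<bar>a $ i - b $ i\<bar> < int n"
  shows "a = b"
proof -
  have "a $ i = b $ i" for i
  proof -
    have "int n dvd a $ i - b $ i" using assms(1) by (simp add: wrap_eq_iff)
    with assms(2)[of i] show ?thesis using zdvd_imp_le[of "int n" "\<bar>a $ i - b $ i\<bar>"] by fastforce
  qed
  then show ?thesis by (simp add: vec_eq_iff)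
qed

section \<open>Balls of the infinite lattice and their group structure\<close>

lemma lattice_walk_translate:
  "(x, y) \<in> lattice_edges p \<rho> ^^ k \<Longrightarrow> (a + x, a + y) \<in> lattice_edges p \<rho> ^^ k"
proof (induction k arbitrary: y)
  case (Suc k)
  then obtain z where z: "(x, z) \<in> lattice_edges p \<rho> ^^ k" "(z, y) \<in> lattice_edges p \<rho>"
    by auto
  from z(2) have "(a + z, a + y) \<in> lattice_edges p \<rho>" by (simp add: lattice_edges_def)
  with Suc.IH[OF z(1)] show ?case by auto
qed simp

lemma lattice_walk_uminus:
  assumes "1 \<le> p"
  shows "(x, y) \<in> lattice_edges p \<rho> ^^ k \<Longrightarrow> (- x, - y) \<in> lattice_edges p \<rho> ^^ k"
proof (induction k arbitrary: y)
  case (Suc k)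
  then obtain z where z: "(x, z) \<in> lattice_edges p \<rho> ^^ k" "(z, y) \<in> lattice_edges p \<rho>"
    by auto
  have "lp_norm p (real_vec (- y - - z)) \<le> lp_norm p (real_vec (y - z))"
    by (rule lp_norm_mono[OF assms]) (simp add: real_vec_def)
  with z(2) have "(- z, - y) \<in> lattice_edges p \<rho>" by (auto simp: lattice_edges_def)
  with Suc.IH[OF z(1)] show ?case by auto
qed simp

lemma lattice_ball_iff: "y \<in> lattice_ball p \<rho> r \<longleftrightarrow> (\<exists>k\<le>r. (0, y) \<in> lattice_edges p \<rho> ^^ k)"
  by (simp add: lattice_ball_def graph_ball_iff)

lemma zero_in_lattice_ball [simp]: "0 \<in> lattice_ball p \<rho> r"
  by (auto simp: lattice_ball_iff intro!: exI[of _ 0])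

lemma lattice_ball_mono: "r \<le> s \<Longrightarrow> lattice_ball p \<rho> r \<subseteq> lattice_ball p \<rho> s"
  by (meson lattice_ball_iff order_trans subsetI)

lemma lattice_ball_add:
  assumes "y \<in> lattice_ball p \<rho> r" "z \<in> lattice_ball p \<rho> s"
  shows "y + z \<in> lattice_ball p \<rho> (r + s)"
proof -
  obtain k l where k: "k \<le> r" "(0, y) \<in> lattice_edges p \<rho> ^^ k"
    and l: "l \<le> s" "(0, z) \<in> lattice_edges p \<rho> ^^ l"
    using assms by (auto simp: lattice_ball_iff)
  have "(0, y + z) \<in> lattice_edges p \<rho> ^^ (k + l)"
    using k(2) lattice_walk_translate[OF l(2), of y] by (auto simp: relpow_add)
  with k(1) l(1) show ?thesis by (auto simp: lattice_ball_iff intro!: exI[of _ "k + l"])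
qed

lemma lattice_ball_uminus:
  "1 \<le> p \<Longrightarrow> z \<in> lattice_ball p \<rho> r \<Longrightarrow> - z \<in> lattice_ball p \<rho> r"
  using lattice_walk_uminus[of p 0 z] by (auto simp: lattice_ball_iff)

text \<open>A walk of \<open>k\<close> steps moves each coordinate by at most
  \<open>\<rho> * k\<close>. The absolute value of \<open>\<rho>\<close> makes the bound monotone in
  the number of steps whatever the sign of \<open>\<rho>\<close>.\<close>

lemma lattice_ball_component:
  fixes y :: "int ^ 'd::finite"
  assumes "1 \<le> p" "y \<in> lattice_ball p \<rho> r"
  shows "real_of_int \<bar>y $ i\<bar> \<le> \<bar>\<rho>\<bar> * r"
proof -
  obtain k where k: "k \<le> r" "(0, y) \<in> lattice_edges p \<rho> ^^ k"
    using assms(2) by (auto simp: lattice_ball_iff)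
  have "real_of_int \<bar>y $ i\<bar> \<le> \<rho> * k" by (rule lattice_walk_component[OF assms(1) k(2)])
  also have "\<dots> \<le> \<bar>\<rho>\<bar> * r" using k(1) by (intro mult_mono) auto
  finally show ?thesis .
qed

lemma finite_lattice_ball:
  assumes "1 \<le> p"
  shows "finite (lattice_ball p \<rho> r :: (int ^ 'd::finite) set)"
proof -
  define K where "K = \<lfloor>\<bar>\<rho>\<bar> * real r\<rfloor>"
  have "lattice_ball p \<rho> r \<subseteq> vec_lambda ` (UNIV \<rightarrow>\<^sub>E {- K..K} :: ('d \<Rightarrow> int) set)"
  proof
    fix y :: "int ^ 'd" assume y: "y \<in> lattice_ball p \<rho> r"
    have "\<bar>y $ i\<bar> \<le> K" for i
      unfolding K_def le_floor_iff by (rule lattice_ball_component[OF assms y])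
    then have "vec_nth y \<in> UNIV \<rightarrow>\<^sub>E {- K..K}" by (auto simp: abs_le_iff minus_le_iff)
    then have "vec_lambda (vec_nth y) \<in> vec_lambda ` (UNIV \<rightarrow>\<^sub>E {- K..K} :: ('d \<Rightarrow> int) set)"
      by (rule imageI)
    then show "y \<in> vec_lambda ` (UNIV \<rightarrow>\<^sub>E {- K..K} :: ('d \<Rightarrow> int) set)"
      by (simp only: vec_nth_inverse)
  qed
  then show ?thesis by (rule finite_subset) (simp add: finite_PiE)
qed

text \<open>Injectivity of the identification of balls, applied to \<open>0\<close> and
  \<open>z\<close>. This is how a large \<open>n\<close> enters the game: a nonzero displacement
  from the ball cannot go round the torus back to its starting point.\<close>

lemma wrap_add_eq_self_iff:
  assumes "1 \<le> p" "n > 0" "real n > 2 * \<rho> * real r" "x \<in> torus n" "z \<in> lattice_ball p \<rho> r"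
  shows "x = wrap n (x + z) \<longleftrightarrow> z = 0"
proof -
  have "inj_on (\<lambda>y. wrap n (x + y)) (lattice_ball p \<rho> r)"
    using bij_betw_lattice_ball[OF assms(1-4)] by (rule bij_betw_imp_inj_on)
  from inj_onD[OF this, of 0 z] assms(4,5) show ?thesis by (auto simp: wrap_eq_self)
qed

text \<open>A walk on the torus lifts step by step to the lattice. From here on, graph distances can
  be handled as displacements in lattice balls.\<close>

lemma graph_dist_torus:
  assumes "n > 0" "x \<in> torus n" "graph_dist (torus_edges p \<rho> n) x y \<le> enat k"
  shows "\<exists>z\<in>lattice_ball p \<rho> k. y = wrap n (x + z)"
proof -
  have "y \<in> graph_ball (torus_edges p \<rho> n) x k" using assms(3) by (simp add: graph_ball_def)
  then obtain j where j: "j \<le> k" "(x, y) \<in> torus_edges p \<rho> n ^^ j" by (auto simp: graph_ball_iff)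
  from torus_walk_to_lattice[OF assms(1,2) j(2)] obtain z
    where z: "wrap n (x + z) = y" "(0, z) \<in> lattice_edges p \<rho> ^^ j" by blast
  then have "z \<in> lattice_ball p \<rho> k" unfolding lattice_ball_iff using j(1) by blast
  with z(1) show ?thesis by blast
qed

text \<open>On a torus that is large compared with \<open>z\<close> and \<open>\<rho>\<close>, a
  nonzero \<open>z\<close> leads from \<open>0\<close> to a neighbour of \<open>0\<close>, by the
  assumption on the associated graph. The edge lifts to a displacement \<open>u\<close> of the
  lattice graph, and \<open>u = z\<close> because both are small. The zero displacement would only
  give loops, which the associated graph ignores, but \<open>0\<close> lies in every ball. The lemma
  makes binary atoms local.\<close>

lemma displacement_in_lattice_ball:
  fixes S :: "'r \<Rightarrow> (int ^ 'd::finite) set"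
  assumes p: "1 \<le> p"
    and graph: "\<And>n. n \<ge> 1 \<Longrightarrow> associated_graph (torus n) (torus_relation n S) = torus_edges p \<rho> n"
  shows "S R \<subseteq> lattice_ball p \<rho> 1"
proof
  fix z assume z: "z \<in> S R"
  show "z \<in> lattice_ball p \<rho> 1"
  proof (cases "z = 0")
    case False
    \<comment> \<open>This size exceeds each coordinate of \<open>z\<close> by more than
      \<open>\<bar>\<rho>\<bar>\<close>, so \<open>z\<close> is not congruent to \<open>0\<close>,
      and a vector congruent to \<open>z\<close> with coordinates bounded by
      \<open>\<bar>\<rho>\<bar>\<close> is \<open>z\<close> itself.\<close>
    define n where "n = nat (1 + \<lceil>\<bar>\<rho>\<bar>\<rceil> + (\<Sum>i\<in>UNIV. \<bar>z $ i\<bar>))"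
    have le: "\<bar>z $ i\<bar> \<le> (\<Sum>i\<in>UNIV. \<bar>z $ i\<bar>)" for i by (rule member_le_sum) auto
    have n: "\<lceil>\<bar>\<rho>\<bar>\<rceil> + \<bar>z $ i\<bar> < int n" for i
      using le[of i] by (simp add: n_def)
    have n0: "n > 0" using n[of undefined] by linarith
    have x: "0 \<in> torus n" using n0 by (simp add: torus_def)
    have ne: "wrap n z \<noteq> 0"
    proof
      assume "wrap n z = 0"
      then have "wrap n z = wrap n 0" using wrap_eq_self[OF x] by simp
      moreover have "\<bar>z $ i - 0 $ i\<bar> < int n" for i
      proof -
        have "0 \<le> \<lceil>\<bar>\<rho>\<bar>\<rceil>" using abs_ge_zero[of \<rho>] by linarith
        then have "\<bar>z $ i\<bar> < int n" using n[of i] by linarith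
        then show ?thesis by simp
      qed
      ultimately have "z = 0" by (rule wrap_eq_imp_eq)
      with False show False ..
    qed
    have "(0, wrap n z) \<in> associated_graph (torus n) (torus_relation n S)"
      using x ne z n0 by (auto simp: associated_graph_def torus_relation_def wrap_in_torus)
    then have "(0, wrap n z) \<in> torus_edges p \<rho> n ^^ 1" using graph[of n] n0 by simp
    from torus_walk_to_lattice[OF n0 x this] obtain u
      where u: "wrap n u = wrap n z" "(0, u) \<in> lattice_edges p \<rho> ^^ 1" by auto
    have ub: "u \<in> lattice_ball p \<rho> 1" unfolding lattice_ball_iff using u(2) by blast
    have "\<bar>u $ i - z $ i\<bar> < int n" for i
    proof -
      have "real_of_int \<bar>u $ i\<bar> \<le> \<bar>\<rho>\<bar>" using lattice_ball_component[OF p ub, of i] by simp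
      then have "\<bar>u $ i\<bar> \<le> \<lceil>\<bar>\<rho>\<bar>\<rceil>" by linarith
      with n[of i] show ?thesis by linarith
    qed
    with u(1) have "u = z" by (rule wrap_eq_imp_eq)
    with ub show ?thesis by simp
  qed simp
qed

text \<open>Points spaced evenly on the diagonal do it. The spacing \<open>K\<close> exceeds the
  coordinates of all displacements in the ball of radius \<open>L\<close>, and \<open>n\<close>
  leaves a gap of at least \<open>K\<close> also across the periodic boundary.\<close>

lemma separated_points_exist:
  assumes p: "1 \<le> p"
  shows "\<forall>\<^sub>F n in sequentially. \<exists>x :: nat \<Rightarrow> int ^ 'd::finite.
    (\<forall>i. i < N \<longrightarrow> x i \<in> torus n) \<and>
    (\<forall>i<N. \<forall>j<N. i \<noteq> j \<longrightarrow> (\<forall>z\<in>lattice_ball p \<rho> L. x j \<noteq> wrap n (x i + z)))"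
proof -
  define K where "K = nat \<lceil>\<bar>\<rho>\<bar> * L\<rceil> + 1"
  have small: "\<bar>z $ i\<bar> < int K" if "z \<in> lattice_ball p \<rho> L" for z :: "int ^ 'd" and i
  proof -
    have "real_of_int \<bar>z $ i\<bar> \<le> \<bar>\<rho>\<bar> * L" by (rule lattice_ball_component[OF p that])
    then show ?thesis unfolding K_def by linarith
  qed
  have "\<exists>x :: nat \<Rightarrow> int ^ 'd. (\<forall>i. i < N \<longrightarrow> x i \<in> torus n) \<and>
    (\<forall>i<N. \<forall>j<N. i \<noteq> j \<longrightarrow> (\<forall>z\<in>lattice_ball p \<rho> L. x j \<noteq> wrap n (x i + z)))"
    if n: "n \<ge> K * (N + 1)" for n
  proof (intro exI conjI allI impI ballI)
    let ?x = "\<lambda>i :: nat. (\<chi> _. int (K * i)) :: int ^ 'd"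
    have lt: "K * i + K \<le> n" if "i < N" for i
    proof -
      have "K * (i + 1) \<le> K * (N + 1)" using that by (intro mult_le_mono) auto
      then have "K * (i + 1) \<le> n" using n by (rule order_trans)
      then show ?thesis by simp
    qed
    have K: "K > 0" by (simp add: K_def)
    show mem: "?x i \<in> torus n" if "i < N" for i
      using lt[OF that] K by (simp add: torus_def) (metis add.commute le_add1 of_nat_mult of_nat_less_iff less_add_same_cancel2 less_le_trans)
    fix i j :: nat and z :: "int ^ 'd"
    assume ij: "i < N" "j < N" "i \<noteq> j" and z: "z \<in> lattice_ball p \<rho> L"
    show "?x j \<noteq> wrap n (?x i + z)"
    proof
      assume "?x j = wrap n (?x i + z)"
      then have "wrap n (?x j) = wrap n (?x i + z)" using wrap_eq_self[OF mem[OF ij(2)]] by simp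
      then have eq: "?x j = ?x i + z"
      proof (rule wrap_eq_imp_eq)
        \<comment> \<open>The difference of two centres plus \<open>K\<close> is at most
          \<open>n\<close>, and \<open>z\<close> is smaller than \<open>K\<close> in each
          coordinate, so the congruence modulo \<open>n\<close> is an equality in the
          lattice.\<close>
        fix k
        have "\<bar>int (K * j) - int (K * i)\<bar> + int K \<le> int n" using lt[OF ij(1)] lt[OF ij(2)] by linarith
        then show "\<bar>?x j $ k - (?x i + z) $ k\<bar> < int n" using small[OF z, of k] by simp
      qed
      fix k
      from eq have "z $ k = int K * (int j - int i)"
        by (simp add: vec_eq_iff algebra_simps)
      then have "\<bar>z $ k\<bar> = int K * \<bar>int j - int i\<bar>" by (simp add: abs_mult)
      moreover have "int K * 1 \<le> int K * \<bar>int j - int i\<bar>" using ij(3) by (intro mult_left_mono) auto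
      ultimately show False using small[OF z, of k] by simp
    qed
  qed
  then show ?thesis by (auto simp: eventually_sequentially)
qed

section \<open>A back-and-forth system\<close>

text \<open>Distance is expressed by displacements. The radius \<open>2 * T\<close> ensures that no
  ball of radius \<open>T\<close> contains two of the \<open>m\<close> places, since two points of
  such a ball differ by a sum of two displacements of radius \<open>T\<close>.\<close>

definition scattered ::
  "ennreal \<Rightarrow> real \<Rightarrow> nat \<Rightarrow> nat \<Rightarrow> nat \<Rightarrow> (int ^ 'd \<Rightarrow> int) \<Rightarrow> (int ^ 'd::finite \<Rightarrow> int) \<Rightarrow> bool" where
  "scattered p \<rho> T m n \<zeta> \<eta> \<longleftrightarrow>
     (\<exists>x. \<forall>i<m. x i \<in> torus n \<and> \<eta> \<in> pattern_event p \<rho> n T \<zeta> (x i) \<and>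
        (\<forall>j<m. i \<noteq> j \<longrightarrow> (\<forall>z\<in>lattice_ball p \<rho> (2 * T). x j \<noteq> wrap n (x i + z))))"

definition rich ::
  "ennreal \<Rightarrow> real \<Rightarrow> nat \<Rightarrow> nat \<Rightarrow> nat \<Rightarrow> (int ^ 'd::finite \<Rightarrow> int) \<Rightarrow> bool" where
  "rich p \<rho> T m n \<eta> \<longleftrightarrow> (\<forall>\<zeta>\<in>local_configs p \<rho> T. scattered p \<rho> T m n \<zeta> \<eta>)"

text \<open>The balls of radius \<open>t\<close> around the values of the variables in \<open>F\<close> correspond. Since \<open>\<int>\<^sup>d\<close>
  acts on both tori, no isomorphism needs to be named.\<close>

definition sim ::
  "ennreal \<Rightarrow> real \<Rightarrow> nat \<Rightarrow> nat set \<Rightarrow> nat \<Rightarrow> (int ^ 'd \<Rightarrow> int) \<Rightarrow> (nat \<Rightarrow> int ^ 'd) \<Rightarrow>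
    nat \<Rightarrow> (int ^ 'd \<Rightarrow> int) \<Rightarrow> (nat \<Rightarrow> int ^ 'd::finite) \<Rightarrow> bool" where
  "sim p \<rho> t F n \<eta> s n' \<eta>' s' \<longleftrightarrow>
     (\<forall>i\<in>F. \<forall>z\<in>lattice_ball p \<rho> t. \<eta> (wrap n (s i + z)) = \<eta>' (wrap n' (s' i + z)) \<and>
        (\<forall>j\<in>F. s j = wrap n (s i + z) \<longleftrightarrow> s' j = wrap n' (s' i + z)))"

section \<open>The moves of the game\<close>

lemma sim_sym: "sim p \<rho> t F n \<eta> s n' \<eta>' s' \<Longrightarrow> sim p \<rho> t F n' \<eta>' s' n \<eta> s"
  by (auto simp: sim_def)

lemma sim_mono:
  "sim p \<rho> t F n \<eta> s n' \<eta>' s' \<Longrightarrow> G \<subseteq> F \<Longrightarrow> u \<le> t \<Longrightarrow> sim p \<rho> u G n \<eta> s n' \<eta>' s'"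
  unfolding sim_def by (meson lattice_ball_mono subsetD)

text \<open>Pigeonhole principle: if each of the \<open>m\<close> places were within
  \<open>T\<close> of some old point, two of them would share that point, as there are fewer than
  \<open>m\<close> old points. They would then differ by a displacement of radius
  \<open>2 * T\<close>.\<close>

lemma rich_avoids:
  fixes \<eta> :: "int ^ 'd::finite \<Rightarrow> int"
  assumes p: "1 \<le> p" and rich: "rich p \<rho> T m n \<eta>" and F: "finite F" "card F < m"
    and s: "range s \<subseteq> torus n" and \<zeta>: "\<zeta> \<in> local_configs p \<rho> T"
  shows "\<exists>v\<in>torus n. \<eta> \<in> pattern_event p \<rho> n T \<zeta> v \<and>
    (\<forall>j\<in>F. \<forall>z\<in>lattice_ball p \<rho> T. v \<noteq> wrap n (s j + z))"
proof (rule ccontr)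
  assume none: "\<not> ?thesis"
  obtain x where "\<forall>i<m. x i \<in> torus n \<and> \<eta> \<in> pattern_event p \<rho> n T \<zeta> (x i) \<and>
      (\<forall>j<m. i \<noteq> j \<longrightarrow> (\<forall>z\<in>lattice_ball p \<rho> (2 * T). x j \<noteq> wrap n (x i + z)))"
    using rich \<zeta> unfolding rich_def scattered_def by blast
  then have x: "x i \<in> torus n" "\<eta> \<in> pattern_event p \<rho> n T \<zeta> (x i)"
    "\<And>j z. j < m \<Longrightarrow> i \<noteq> j \<Longrightarrow> z \<in> lattice_ball p \<rho> (2 * T) \<Longrightarrow> x j \<noteq> wrap n (x i + z)"
    if "i < m" for i
    using that by blast+
  have "\<forall>i\<in>{..<m}. \<exists>j\<in>F. \<exists>z\<in>lattice_ball p \<rho> T. x i = wrap n (s j + z)"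
    using none x(1,2) by auto
  then obtain f where f: "f i \<in> F" "\<exists>z\<in>lattice_ball p \<rho> T. x i = wrap n (s (f i) + z)"
    if "i < m" for i
    by (metis lessThan_iff)
  have "\<not> inj_on f {..<m}"
  proof
    assume "inj_on f {..<m}"
    then have "card {..<m} \<le> card F" using f(1) F(1) by (intro card_inj_on_le) auto
    with F(2) show False by simp
  qed
  then obtain i j where ij: "i < m" "j < m" "i \<noteq> j" "f i = f j" by (auto simp: inj_on_def)
  obtain y z where y: "y \<in> lattice_ball p \<rho> T" "x i = wrap n (s (f i) + y)"
    and z: "z \<in> lattice_ball p \<rho> T" "x j = wrap n (s (f i) + z)"
    using f(2)[OF ij(1)] f(2)[OF ij(2)] ij(4) by auto
  have "z + - y \<in> lattice_ball p \<rho> (2 * T)"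
    using lattice_ball_add[OF z(1) lattice_ball_uminus[OF p y(1)]] by (simp add: mult_2)
  moreover have "x j = wrap n (x i + (z + - y))"
    unfolding y(2) z(2) wrap_wrap_add by simp
  ultimately show False using x(3)[OF ij(1-3)] by blast
qed

text \<open>One move of the game: the spoiler plays \<open>v\<close> on the first torus and the
  duplicator answers on the second, which is why richness is asked of \<open>\<eta>'\<close>. The
  move halves the radius; moves in the other direction are obtained through
  \<open>sim_sym\<close>.\<close>

lemma sim_extend:
  fixes s s' :: "nat \<Rightarrow> int ^ 'd::finite"
  assumes p: "1 \<le> p" and n: "n > 0" "real n > 2 * \<rho> * real T"
    and n': "n' > 0" "real n' > 2 * \<rho> * real T"
    and \<eta>: "\<eta> \<in> configs n" and rich: "rich p \<rho> T m n' \<eta>'"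
    and F: "finite F" "card F < m" and t: "t \<le> T"
    and s: "range s \<subseteq> torus n" and s': "range s' \<subseteq> torus n'"
    and sim: "sim p \<rho> (2 * t) F n \<eta> s n' \<eta>' s'" and i: "i \<notin> F" and v: "v \<in> torus n"
  shows "\<exists>v'\<in>torus n'. sim p \<rho> t (insert i F) n \<eta> (s(i := v)) n' \<eta>' (s'(i := v'))"
proof -
  \<comment> \<open>Only comparisons starting at the new point have to be checked. Those from an old
    point to the new one follow by negating the displacement, those of the new point with itself
    hold because only \<open>z = 0\<close> fixes a point, and those among old points are
    inherited.\<close>
  have suffices: "sim p \<rho> t (insert i F) n \<eta> (s(i := v)) n' \<eta>' (s'(i := v'))"
    if v': "v' \<in> torus n'"
      and col: "\<And>z. z \<in> lattice_ball p \<rho> t \<Longrightarrow> \<eta> (wrap n (v + z)) = \<eta>' (wrap n' (v' + z))"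
      and rel: "\<And>j z. j \<in> F \<Longrightarrow> z \<in> lattice_ball p \<rho> t \<Longrightarrow>
        s j = wrap n (v + z) \<longleftrightarrow> s' j = wrap n' (v' + z)" for v'
  proof -
    have self: "v = wrap n (v + z) \<longleftrightarrow> v' = wrap n' (v' + z)" if z: "z \<in> lattice_ball p \<rho> t" for z
    proof -
      have "z \<in> lattice_ball p \<rho> T" using z lattice_ball_mono[OF t] by blast
      then show ?thesis
        using wrap_add_eq_self_iff[OF p n v] wrap_add_eq_self_iff[OF p n' v'] by blast
    qed
    have rel': "v = wrap n (s j + z) \<longleftrightarrow> v' = wrap n' (s' j + z)"
      if j: "j \<in> F" and z: "z \<in> lattice_ball p \<rho> t" for j z
    proof -
      have "s j \<in> torus n" "s' j \<in> torus n'" using s s' by auto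
      then show ?thesis
        using wrap_add_eq_iff[of "s j" n v z] wrap_add_eq_iff[of "s' j" n' v' z] v v'
          rel[OF j lattice_ball_uminus[OF p z]] by simp
    qed
    have "sim p \<rho> t F n \<eta> s n' \<eta>' s'" using sim by (rule sim_mono) auto
    then have old: "\<eta> (wrap n (s k + z)) = \<eta>' (wrap n' (s' k + z))"
        "s j = wrap n (s k + z) \<longleftrightarrow> s' j = wrap n' (s' k + z)"
      if "k \<in> F" "j \<in> F" "z \<in> lattice_ball p \<rho> t" for j k z
      using that by (auto simp: sim_def)
    show ?thesis
      unfolding sim_def
    proof (intro ballI conjI)
      fix k and z :: "int ^ 'd" assume k: "k \<in> insert i F" and z: "z \<in> lattice_ball p \<rho> t"
      show "\<eta> (wrap n ((s(i := v)) k + z)) = \<eta>' (wrap n' ((s'(i := v')) k + z))"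
        using k col[OF z] old(1)[OF _ _ z] by (cases "k = i") auto
      fix j assume j: "j \<in> insert i F"
      show "(s(i := v)) j = wrap n ((s(i := v)) k + z) \<longleftrightarrow> (s'(i := v')) j = wrap n' ((s'(i := v')) k + z)"
        using k j rel[OF _ z] rel'[OF _ z] self[OF z] old(2)[OF _ _ z]
        by (cases "k = i"; cases "j = i") auto
    qed
  qed
  show ?thesis
  proof (cases "\<exists>j\<in>F. \<exists>z\<in>lattice_ball p \<rho> t. v = wrap n (s j + z)")
    case True
    then obtain k y where k: "k \<in> F" and y: "y \<in> lattice_ball p \<rho> t" "v = wrap n (s k + y)" by auto
    define v' where "v' = wrap n' (s' k + y)"
    have v': "v' \<in> torus n'" using n' by (simp add: v'_def wrap_in_torus)
    have shift: "wrap n (v + z) = wrap n (s k + (y + z))" "wrap n' (v' + z) = wrap n' (s' k + (y + z))" for z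
      by (simp_all add: y(2) v'_def wrap_wrap_add add.assoc)
    \<comment> \<open>The ball of radius \<open>t\<close> around the new point lies in the ball of
      radius \<open>2 * t\<close> around \<open>s k\<close>; hence the doubled radius in the
      assumption on \<open>sim\<close>.\<close>
    have yz: "y + z \<in> lattice_ball p \<rho> (2 * t)" if "z \<in> lattice_ball p \<rho> t" for z
      using lattice_ball_add[OF y(1) that] by (simp add: mult_2)
    have "sim p \<rho> t (insert i F) n \<eta> (s(i := v)) n' \<eta>' (s'(i := v'))"
    proof (rule suffices[OF v'])
      fix z :: "int ^ 'd" assume "z \<in> lattice_ball p \<rho> t"
      then have *: "y + z \<in> lattice_ball p \<rho> (2 * t)" by (rule yz)
      with sim k show "\<eta> (wrap n (v + z)) = \<eta>' (wrap n' (v' + z))"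
        unfolding sim_def shift by blast
      fix j assume "j \<in> F"
      with sim k * show "s j = wrap n (v + z) \<longleftrightarrow> s' j = wrap n' (v' + z)"
        unfolding sim_def shift by blast
    qed
    with v' show ?thesis by blast
  next
    case False
    \<comment> \<open>The surroundings of \<open>v\<close>, read as a local configuration. Their
      radius is \<open>T\<close> rather than \<open>t\<close>, because richness speaks of patterns
      of radius \<open>T\<close>; restriction to the ball gives the extensional function required by
      \<open>local_configs\<close>.\<close>
    define \<zeta> where "\<zeta> = restrict (\<lambda>z. \<eta> (wrap n (v + z))) (lattice_ball p \<rho> T)"
    have "\<zeta> \<in> local_configs p \<rho> T"
    proof -
      have "\<eta> (wrap n x) \<in> {- 1, 1}" for x
        using \<eta> wrap_in_torus[OF n(1)] unfolding configs_def by (rule PiE_mem)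
      then show ?thesis unfolding \<zeta>_def local_configs_def by (auto simp: PiE_def)
    qed
    from rich_avoids[OF p rich F s' this] obtain v' where v': "v' \<in> torus n'"
      "\<eta>' \<in> pattern_event p \<rho> n' T \<zeta> v'"
      and far: "\<And>j z. j \<in> F \<Longrightarrow> z \<in> lattice_ball p \<rho> T \<Longrightarrow> v' \<noteq> wrap n' (s' j + z)" by blast
    have "sim p \<rho> t (insert i F) n \<eta> (s(i := v)) n' \<eta>' (s'(i := v'))"
    proof (rule suffices[OF v'(1)])
      fix z :: "int ^ 'd" assume z: "z \<in> lattice_ball p \<rho> t"
      then have zT: "z \<in> lattice_ball p \<rho> T" using lattice_ball_mono[OF t] by blast
      with v'(2) show "\<eta> (wrap n (v + z)) = \<eta>' (wrap n' (v' + z))"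
        by (simp add: pattern_event_def \<zeta>_def)
      fix j assume j: "j \<in> F"
      have "s j \<in> torus n" "s' j \<in> torus n'" using s s' by auto
      \<comment> \<open>Both sides of the equivalence are false: \<open>v\<close> is far from the
        old points by the case assumption, \<open>v'\<close> by its choice.\<close>
      moreover have "v \<noteq> wrap n (s j + - z)" using False j lattice_ball_uminus[OF p z] by blast
      moreover have "v' \<noteq> wrap n' (s' j + - z)" by (rule far[OF j lattice_ball_uminus[OF p zT]])
      ultimately show "s j = wrap n (v + z) \<longleftrightarrow> s' j = wrap n' (v' + z)"
        using wrap_add_eq_iff[OF v, of "s j" z] wrap_add_eq_iff[OF v'(1), of "s' j" z] by simp
    qed
    with v'(1) show ?thesis by blast
  qed
qed

section \<open>Preservation of first-order formulas\<close>

primrec locality_radius :: "'r formula \<Rightarrow> nat" where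
  "locality_radius (Unary i) = 1"
| "locality_radius (Binary R i j) = 1"
| "locality_radius (Equal i j) = 1"
| "locality_radius (Neg A) = locality_radius A"
| "locality_radius (Conj A B) = max (locality_radius A) (locality_radius B)"
| "locality_radius (Forall i A) = 2 * locality_radius A"
| "locality_radius (Exists i A) = 2 * locality_radius A"

text \<open>A bound for the number of free variables, hence of old points to be avoided. In contrast
  to that number it does not decrease from a subformula to the formula, so a single \<open>m\<close>
  serves throughout the induction.\<close>

primrec occurrences :: "'r formula \<Rightarrow> nat" where
  "occurrences (Unary i) = 1"
| "occurrences (Binary R i j) = 2"
| "occurrences (Equal i j) = 2"
| "occurrences (Neg A) = occurrences A"
| "occurrences (Conj A B) = occurrences A + occurrences B"
| "occurrences (Forall i A) = occurrences A"
| "occurrences (Exists i A) = occurrences A"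

lemma finite_free_vars [simp]: "finite (free_vars A)"
  by (induction A) auto

lemma card_free_vars_le: "card (free_vars A) \<le> occurrences A"
proof (induction A)
  case (Conj A B)
  then show ?case using card_Un_le[of "free_vars A" "free_vars B"] by simp
next
  case (Forall i A)
  then show ?case using card_Diff1_le[of "free_vars A" i] by simp
next
  case (Exists i A)
  then show ?case using card_Diff1_le[of "free_vars A" i] by simp
qed (auto simp: card_insert_if)

text \<open>Induction on the formula, with \<open>T\<close> and \<open>m\<close> fixed and the
  assignments arbitrary. At atoms, \<open>locality_radius\<close> is \<open>1\<close>, enough to
  reach all displacements in \<open>S R\<close>. It doubles at each quantifier, which pays for the
  move made there by \<open>sim_extend\<close>.\<close>

lemma sat_iff_if_sim:
  fixes S :: "'r \<Rightarrow> (int ^ 'd::finite) set"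
  assumes p: "1 \<le> p" and S: "\<And>R. S R \<subseteq> lattice_ball p \<rho> 1"
    and n: "n > 0" "real n > 2 * \<rho> * real T"
    and n': "n' > 0" "real n' > 2 * \<rho> * real T"
    and \<eta>: "\<eta> \<in> configs n" and \<eta>': "\<eta>' \<in> configs n'"
    and rich: "rich p \<rho> T m n \<eta>" and rich': "rich p \<rho> T m n' \<eta>'"
  shows "locality_radius A \<le> T \<Longrightarrow> occurrences A < m \<Longrightarrow> range s \<subseteq> torus n \<Longrightarrow> range s' \<subseteq> torus n' \<Longrightarrow>
    sim p \<rho> (locality_radius A) (free_vars A) n \<eta> s n' \<eta>' s' \<Longrightarrow>
    sat (torus n) {x \<in> torus n. \<eta> x = 1} (torus_relation n S) s A \<longleftrightarrow>
    sat (torus n') {x \<in> torus n'. \<eta>' x = 1} (torus_relation n' S) s' A"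
proof (induction A arbitrary: s s')
  case (Unary i)
  have mem: "s i \<in> torus n" "s' i \<in> torus n'" using Unary.prems(3,4) by auto
  have "\<eta> (wrap n (s i + 0)) = \<eta>' (wrap n' (s' i + 0))"
    using Unary.prems(5) zero_in_lattice_ball unfolding sim_def by (metis free_vars.simps(1) insertI1)
  with mem show ?case by (simp add: wrap_eq_self)
next
  case (Binary R i j)
  have "s j = wrap n (s i + z) \<longleftrightarrow> s' j = wrap n' (s' i + z)" if "z \<in> S R" for z
    using Binary.prems(5) that S[of R] by (auto simp: sim_def)
  moreover have "s i \<in> torus n" "s' i \<in> torus n'" "s j \<in> torus n" "s' j \<in> torus n'"
    using Binary.prems(3,4) by auto
  ultimately show ?case by (auto simp: torus_relation_def)
next
  case (Equal i j)
  have mem: "s i \<in> torus n" "s' i \<in> torus n'" using Equal.prems(3,4) by auto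
  have "s j = wrap n (s i + 0) \<longleftrightarrow> s' j = wrap n' (s' i + 0)"
    using Equal.prems(5) zero_in_lattice_ball unfolding sim_def
    by (metis free_vars.simps(3) insertI1 insertI2)
  then have "s j = s i \<longleftrightarrow> s' j = s' i" using mem by (simp add: wrap_eq_self)
  then show ?case unfolding sat.simps by metis
next
  case (Neg A)
  then show ?case by simp
next
  case (Conj A B)
  have "sim p \<rho> (locality_radius A) (free_vars A) n \<eta> s n' \<eta>' s'"
    "sim p \<rho> (locality_radius B) (free_vars B) n \<eta> s n' \<eta>' s'"
    using Conj.prems(5) by (auto intro: sim_mono)
  with Conj show ?case by simp
next
  case (Forall i A)
  \<comment> \<open>Removing \<open>i\<close> drops its old value before the move, as
    \<open>sim_extend\<close> requires; bound variables may thus be reused without renaming.\<close>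
  let ?F = "free_vars A - {i}" and ?t = "locality_radius A"
  have t: "?t \<le> T" and occ: "occurrences A < m" using Forall.prems(1,2) by auto
  have card: "card ?F < m" using card_free_vars_le[of "Forall i A"] occ by simp
  have sim: "sim p \<rho> (2 * ?t) ?F n \<eta> s n' \<eta>' s'" using Forall.prems(5) by simp
  have IH: "sat (torus n) {x \<in> torus n. \<eta> x = 1} (torus_relation n S) (s(i := v)) A \<longleftrightarrow>
      sat (torus n') {x \<in> torus n'. \<eta>' x = 1} (torus_relation n' S) (s'(i := v')) A"
    if "v \<in> torus n" "v' \<in> torus n'" "sim p \<rho> ?t (insert i ?F) n \<eta> (s(i := v)) n' \<eta>' (s'(i := v'))" for v v'
  proof (rule Forall.IH[OF t occ])
    show "sim p \<rho> ?t (free_vars A) n \<eta> (s(i := v)) n' \<eta>' (s'(i := v'))"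
      using that(3) by (rule sim_mono) auto
  qed (use that Forall.prems(3,4) in \<open>auto split: if_splits\<close>)
  have zig: "\<exists>v'\<in>torus n'. sim p \<rho> ?t (insert i ?F) n \<eta> (s(i := v)) n' \<eta>' (s'(i := v'))"
    if "v \<in> torus n" for v
    by (rule sim_extend[OF p n n' \<eta> rich' _ card t Forall.prems(3,4) sim _ that]) auto
  \<comment> \<open>The same move with the two configurations exchanged.\<close>
  have zag: "\<exists>v\<in>torus n. sim p \<rho> ?t (insert i ?F) n \<eta> (s(i := v)) n' \<eta>' (s'(i := v'))"
    if "v' \<in> torus n'" for v'
  proof -
    have "\<exists>v\<in>torus n. sim p \<rho> ?t (insert i ?F) n' \<eta>' (s'(i := v')) n \<eta> (s(i := v))"
      by (rule sim_extend[OF p n' n \<eta>' rich _ card t Forall.prems(4,3) sim_sym[OF sim] _ that]) auto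
    then show ?thesis by (blast intro: sim_sym)
  qed
  show ?case
    unfolding sat.simps using IH zig zag by meson
next
  case (Exists i A)
  let ?F = "free_vars A - {i}" and ?t = "locality_radius A"
  have t: "?t \<le> T" and occ: "occurrences A < m" using Exists.prems(1,2) by auto
  have card: "card ?F < m" using card_free_vars_le[of "Exists i A"] occ by simp
  have sim: "sim p \<rho> (2 * ?t) ?F n \<eta> s n' \<eta>' s'" using Exists.prems(5) by simp
  have IH: "sat (torus n) {x \<in> torus n. \<eta> x = 1} (torus_relation n S) (s(i := v)) A \<longleftrightarrow>
      sat (torus n') {x \<in> torus n'. \<eta>' x = 1} (torus_relation n' S) (s'(i := v')) A"
    if "v \<in> torus n" "v' \<in> torus n'" "sim p \<rho> ?t (insert i ?F) n \<eta> (s(i := v)) n' \<eta>' (s'(i := v'))" for v v'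
  proof (rule Exists.IH[OF t occ])
    show "sim p \<rho> ?t (free_vars A) n \<eta> (s(i := v)) n' \<eta>' (s'(i := v'))"
      using that(3) by (rule sim_mono) auto
  qed (use that Exists.prems(3,4) in \<open>auto split: if_splits\<close>)
  have zig: "\<exists>v'\<in>torus n'. sim p \<rho> ?t (insert i ?F) n \<eta> (s(i := v)) n' \<eta>' (s'(i := v'))"
    if "v \<in> torus n" for v
    by (rule sim_extend[OF p n n' \<eta> rich' _ card t Exists.prems(3,4) sim _ that]) auto
  have zag: "\<exists>v\<in>torus n. sim p \<rho> ?t (insert i ?F) n \<eta> (s(i := v)) n' \<eta>' (s'(i := v'))"
    if "v' \<in> torus n'" for v'
  proof -
    have "\<exists>v\<in>torus n. sim p \<rho> ?t (insert i ?F) n' \<eta>' (s'(i := v')) n \<eta> (s(i := v))"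
      by (rule sim_extend[OF p n' n \<eta>' rich _ card t Exists.prems(4,3) sim_sym[OF sim] _ that]) auto
    then show ?thesis by (blast intro: sim_sym)
  qed
  show ?case
    unfolding sat.simps using IH zig zag by meson
qed

text \<open>A sentence has no free variables, so \<open>sim\<close> holds vacuously and the game can
  start from any two assignments.\<close>

lemma models_iff_if_rich:
  fixes S :: "'r \<Rightarrow> (int ^ 'd::finite) set"
  assumes p: "1 \<le> p" and S: "\<And>R. S R \<subseteq> lattice_ball p \<rho> 1" and A: "sentence A"
    and T: "locality_radius A \<le> T" and m: "occurrences A < m"
    and n: "n > 0" "real n > 2 * \<rho> * real T" "\<eta> \<in> configs n" "rich p \<rho> T m n \<eta>"
    and n': "n' > 0" "real n' > 2 * \<rho> * real T" "\<eta>' \<in> configs n'" "rich p \<rho> T m n' \<eta>'"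
  shows "models n (torus_relation n S) \<eta> A \<longleftrightarrow> models n' (torus_relation n' S) \<eta>' A"
proof -
  let ?sat = "\<lambda>s. sat (torus n) {x \<in> torus n. \<eta> x = 1} (torus_relation n S) s A"
  let ?sat' = "\<lambda>s. sat (torus n') {x \<in> torus n'. \<eta>' x = 1} (torus_relation n' S) s A"
  have eq: "?sat s \<longleftrightarrow> ?sat' s'" if "range s \<subseteq> torus n" "range s' \<subseteq> torus n'" for s s'
    using sat_iff_if_sim[OF p S n(1,2) n'(1,2) n(3) n'(3) n(4) n'(4) T m that] A
    by (simp add: sim_def sentence_def)
  have ne: "range (\<lambda>_. 0) \<subseteq> torus n" "range (\<lambda>_. 0) \<subseteq> torus n'"
    using n(1) n'(1) by (auto simp: torus_def)
  \<comment> \<open>Every assignment on one torus is compared with the zero assignment on the other,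
    which is available because \<open>n\<close> and \<open>n'\<close> are positive. Hence the
    universal quantifier in \<open>models\<close> can be replaced by one assignment.\<close>
  have "models n (torus_relation n S) \<eta> A \<longleftrightarrow> ?sat (\<lambda>_. 0)"
    unfolding models_def using eq[OF _ ne(2)] ne(1) by blast
  moreover have "models n' (torus_relation n' S) \<eta>' A \<longleftrightarrow> ?sat' (\<lambda>_. 0)"
    unfolding models_def using eq[OF ne(1)] ne(2) by blast
  ultimately show ?thesis using eq[OF ne] by simp
qed

section \<open>Almost all configurations are rich\<close>

lemma eventually_nat_real: "\<forall>\<^sub>F n in sequentially. real n > c"
  using filterlim_real_sequentially by (simp add: filterlim_at_top_dense)

text \<open>At infinite distance the rate is \<open>0\<close>, which is at most
  \<open>\<epsilon> L\<close> since a sequence decreasing to \<open>0\<close> is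
  nonnegative.\<close>

lemma rate_at_le:
  assumes "decseq \<epsilon>" "\<epsilon> \<longlonglongrightarrow> 0" "enat L \<le> k"
  shows "rate_at \<epsilon> k \<le> \<epsilon> L"
proof (cases k)
  case (enat l)
  then show ?thesis using assms(1,3) by (simp add: rate_at_def decseqD)
next
  case infinity
  then show ?thesis using decseq_ge[OF assms(1,2), of L] by (simp add: rate_at_def)
qed

text \<open>Contrapositive of \<open>graph_dist_torus\<close>. The infimum over an empty set is
  \<open>\<infinity>\<close>, which covers the empty \<open>C\<close> arising at the first centre in
  \<open>measure_avoid_patterns_le\<close>.\<close>

lemma set_dist_ge:
  assumes "n > 0" "B \<subseteq> torus n"
    and far: "\<And>u v z. u \<in> B \<Longrightarrow> v \<in> C \<Longrightarrow> z \<in> lattice_ball p \<rho> L \<Longrightarrow> v \<noteq> wrap n (u + z)"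
  shows "enat L \<le> set_dist (torus_edges p \<rho> n) B C"
  unfolding set_dist_def
proof (intro INF_greatest)
  fix u v assume uv: "u \<in> B" "v \<in> C"
  show "enat L \<le> graph_dist (torus_edges p \<rho> n) u v"
  proof (rule ccontr)
    assume "\<not> ?thesis"
    then have "graph_dist (torus_edges p \<rho> n) u v \<le> enat L" by simp
    from graph_dist_torus[OF assms(1) _ this] uv far assms(2) show False by blast
  qed
qed

text \<open>Induction on the number of centres. Avoiding the pattern at the last centre and avoiding
  it at all earlier ones are events local to sets at distance at least \<open>L\<close>, so mixing
  lets their probabilities multiply up to an error \<open>\<Psi> * \<epsilon> L\<close>. The bound
  \<open>K\<close> on the number of centres limits the sizes of these sets, so that one
  \<open>\<Psi>\<close> serves for all steps.\<close>

lemma measure_avoid_patterns_le: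
  fixes M :: "(int ^ 'd::finite \<Rightarrow> int) measure"
  assumes p: "1 \<le> p" and n: "n > 0"
    and M: "prob_space M" "space M = configs n" "sets M = Pow (configs n)"
    and mixing: "\<And>B C e\<^sub>B e\<^sub>C. B \<subseteq> torus n \<Longrightarrow> C \<subseteq> torus n \<Longrightarrow> B \<inter> C = {} \<Longrightarrow>
      local_event n B e\<^sub>B \<Longrightarrow> local_event n C e\<^sub>C \<Longrightarrow>
      \<bar>measure M (e\<^sub>B \<inter> e\<^sub>C) - measure M e\<^sub>B * measure M e\<^sub>C\<bar>
        \<le> \<psi> (card B) (card C) * rate_at \<epsilon> (set_dist (torus_edges p \<rho> n) B C)"
    and \<epsilon>: "decseq \<epsilon>" "\<epsilon> \<longlonglongrightarrow> 0"
    and q: "0 \<le> q" "\<And>x. x \<in> torus n \<Longrightarrow> q \<le> measure M (pattern_event p \<rho> n T \<zeta> x)"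
    and \<Psi>: "0 \<le> \<Psi>" "\<And>a c. a \<le> card (lattice_ball p \<rho> T :: (int ^ 'd) set) \<Longrightarrow>
      c \<le> K * card (lattice_ball p \<rho> T :: (int ^ 'd) set) \<Longrightarrow> \<psi> a c \<le> \<Psi>"
  shows "k \<le> K \<Longrightarrow> (\<And>i. i < k \<Longrightarrow> x i \<in> torus n) \<Longrightarrow>
    (\<And>i j z. i < k \<Longrightarrow> j < k \<Longrightarrow> i \<noteq> j \<Longrightarrow> z \<in> lattice_ball p \<rho> (2 * T + L) \<Longrightarrow> x j \<noteq> wrap n (x i + z)) \<Longrightarrow>
    measure M {\<eta> \<in> configs n. \<forall>i<k. \<eta> \<notin> pattern_event p \<rho> n T \<zeta> (x i)} \<le> (1 - q) ^ k + k * \<Psi> * \<epsilon> L"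
proof (induction k)
  case 0
  then show ?case using prob_space.prob_le_1[OF M(1)] by simp
next
  case (Suc k)
  interpret prob_space M by (fact M(1))
  let ?ball = "\<lambda>v. (\<lambda>y. wrap n (v + y)) ` (lattice_ball p \<rho> T :: (int ^ 'd) set)"
  let ?pat = "\<lambda>v. pattern_event p \<rho> n T \<zeta> v"
  let ?b = "card (lattice_ball p \<rho> T :: (int ^ 'd) set)"
  define eB where "eB = configs n - ?pat (x k)"
  define eC where "eC = {\<eta> \<in> configs n. \<forall>i<k. \<eta> \<notin> ?pat (x i)}"
  define B where "B = ?ball (x k)"
  define C where "C = (\<Union>i<k. ?ball (x i))"
  have xk: "x k \<in> torus n" using Suc.prems(2) by simp
  have xi: "x i \<in> torus n" if "i < k" for i using Suc.prems(2) that by simp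
  have pat: "?pat v \<in> events" for v by (auto simp: M(3) pattern_event_def)
  \<comment> \<open>A short way from \<open>u\<close> to \<open>v\<close> would combine with the
    ways from \<open>x k\<close> to \<open>u\<close> and from \<open>v\<close> back to
    \<open>x i\<close> into a displacement of radius \<open>T + T + L\<close>, against the
    separation of the centres.\<close>
  have far: "v \<noteq> wrap n (u + w)" if uv: "u \<in> B" "v \<in> C" and w: "w \<in> lattice_ball p \<rho> L" for u v w
  proof
    assume eq: "v = wrap n (u + w)"
    obtain y where y: "y \<in> lattice_ball p \<rho> T" "u = wrap n (x k + y)" using uv(1) by (auto simp: B_def)
    obtain i z where i: "i < k" and z: "z \<in> lattice_ball p \<rho> T" "v = wrap n (x i + z)"
      using uv(2) by (auto simp: C_def)
    have "v \<in> torus n" using z(2) n by (simp add: wrap_in_torus)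
    then have "x i = wrap n (v + - z)" using wrap_add_eq_iff[OF xi[OF i]] z(2) by blast
    also have "\<dots> = wrap n (x k + (y + - z + w))"
      unfolding eq y(2) wrap_wrap_add by (simp add: add_ac wrap_wrap_add)
        (metis add.commute add.left_commute wrap_wrap_add diff_conv_add_uminus)
    finally have "x i = wrap n (x k + (y + - z + w))" .
    moreover have "y + - z + w \<in> lattice_ball p \<rho> (2 * T + L)"
      using lattice_ball_add[OF lattice_ball_add[OF y(1) lattice_ball_uminus[OF p z(1)]] w]
      by (simp add: mult_2)
    ultimately show False using Suc.prems(3)[of k i] i by (metis less_Suc_eq nat_neq_iff)
  qed
  have BC: "B \<subseteq> torus n" "C \<subseteq> torus n" using n by (auto simp: B_def C_def wrap_in_torus)
  have disj: "B \<inter> C = {}"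
  proof -
    have "u \<notin> C" if u: "u \<in> B" for u
    proof
      assume "u \<in> C"
      \<comment> \<open>Disjointness is the case of displacement \<open>0\<close>.\<close>
      from far[OF u this zero_in_lattice_ball] wrap_eq_self[of u n] u BC(1) show False by auto
    qed
    then show ?thesis by blast
  qed
  have loc: "local_event n B eB" "local_event n C eC"
  proof -
    have pat_iff: "\<eta> \<in> ?pat v \<longleftrightarrow> \<eta>' \<in> ?pat v"
      if "\<eta> \<in> configs n" "\<eta>' \<in> configs n" "\<forall>u\<in>?ball v. \<eta> u = \<eta>' u" for \<eta> \<eta>' v
      using that by (simp add: pattern_event_def)
    show "local_event n B eB"
      using pat_iff[of _ _ "x k"] unfolding local_event_def B_def eB_def by blast
    show "local_event n C eC"
      unfolding local_event_def
    proof (intro conjI ballI impI)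
      fix \<eta> \<eta>' :: "int ^ 'd \<Rightarrow> int"
      assume \<eta>: "\<eta> \<in> configs n" "\<eta>' \<in> configs n" "\<forall>u\<in>C. \<eta> u = \<eta>' u"
      have "\<eta> \<in> ?pat (x i) \<longleftrightarrow> \<eta>' \<in> ?pat (x i)" if "i < k" for i
      proof (rule pat_iff[OF \<eta>(1,2)])
        show "\<forall>u\<in>?ball (x i). \<eta> u = \<eta>' u" using \<eta>(3) that unfolding C_def by blast
      qed
      with \<eta> show "\<eta> \<in> eC \<longleftrightarrow> \<eta>' \<in> eC" by (simp add: eC_def)
    qed (auto simp: eC_def)
  qed
  have fin: "finite (lattice_ball p \<rho> T :: (int ^ 'd) set)" by (rule finite_lattice_ball[OF p])
  have cards: "card B \<le> ?b" "card C \<le> K * ?b"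
  proof -
    show "card B \<le> ?b" unfolding B_def by (rule card_image_le[OF fin])
    have "card C \<le> (\<Sum>i<k. card (?ball (x i)))" unfolding C_def by (rule card_UN_le) simp
    also have "\<dots> \<le> (\<Sum>i<k. ?b)" by (intro sum_mono card_image_le fin)
    also have "\<dots> \<le> K * ?b" using Suc.prems(1) by simp
    finally show "card C \<le> K * ?b" .
  qed
  have \<epsilon>0: "0 \<le> \<epsilon> L" by (rule decseq_ge[OF \<epsilon>])
  have "\<psi> (card B) (card C) * rate_at \<epsilon> (set_dist (torus_edges p \<rho> n) B C) \<le> \<Psi> * \<epsilon> L"
  proof -
    have r: "rate_at \<epsilon> (set_dist (torus_edges p \<rho> n) B C) \<le> \<epsilon> L"
      by (intro rate_at_le[OF \<epsilon>] set_dist_ge[OF n BC(1)] far)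
    have r0: "0 \<le> rate_at \<epsilon> (set_dist (torus_edges p \<rho> n) B C)"
      using decseq_ge[OF \<epsilon>] by (auto simp: rate_at_def split: enat.split)
    \<comment> \<open>\<open>\<psi>\<close> may take negative values; the product is monotone here
      because \<open>\<Psi>\<close> and the rate are nonnegative.\<close>
    show ?thesis using \<Psi>(2)[OF cards] r r0 \<Psi>(1) by (intro mult_mono) auto
  qed
  then have indep: "measure M (eB \<inter> eC) \<le> measure M eB * measure M eC + \<Psi> * \<epsilon> L"
    using mixing[OF BC disj loc] by linarith
  have q1: "q \<le> 1" using q(2)[OF xk] prob_le_1[of "?pat (x k)"] by linarith
  have eB: "measure M eB \<le> 1 - q"
    using prob_compl[OF pat[of "x k"]] q(2)[OF xk] by (simp add: eB_def M(2))
  have IH: "measure M eC \<le> (1 - q) ^ k + k * \<Psi> * \<epsilon> L"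
    unfolding eC_def using Suc.prems by (intro Suc.IH) auto
  have "{\<eta> \<in> configs n. \<forall>i<Suc k. \<eta> \<notin> ?pat (x i)} = eB \<inter> eC"
    by (auto simp: eB_def eC_def less_Suc_eq)
  then have "measure M {\<eta> \<in> configs n. \<forall>i<Suc k. \<eta> \<notin> ?pat (x i)}
      \<le> measure M eB * measure M eC + \<Psi> * \<epsilon> L" using indep by simp
  also have "measure M eB * measure M eC \<le> (1 - q) * ((1 - q) ^ k + k * \<Psi> * \<epsilon> L)"
    using eB IH q1 by (intro mult_mono) auto
  also have "(1 - q) * ((1 - q) ^ k + k * \<Psi> * \<epsilon> L) \<le> (1 - q) ^ Suc k + k * \<Psi> * \<epsilon> L"
  proof -
    \<comment> \<open>The factor \<open>1 - q\<close> is at most \<open>1\<close>, so earlier errors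
      do not grow and the errors simply add up.\<close>
    have "(1 - q) * (k * \<Psi> * \<epsilon> L) \<le> 1 * (k * \<Psi> * \<epsilon> L)"
      using q(1) \<Psi>(1) \<epsilon>0 by (intro mult_right_mono) auto
    then show ?thesis by (simp add: algebra_simps)
  qed
  finally show ?case by (simp add: algebra_simps)
qed

text \<open>The choices are made in this order: \<open>k\<close> makes \<open>(1 - q') ^ k\<close>
  small, then \<open>L\<close> makes the mixing error small, with \<open>\<Psi>\<close> depending on
  \<open>k\<close>, and finally \<open>n\<close> is large enough for \<open>m * k\<close> centres.
  If each of the \<open>m\<close> groups contains an occurrence, one from each group gives the
  required places.\<close>

lemma not_scattered_tendsto_0:
  fixes \<mu> :: "nat \<Rightarrow> (int ^ 'd::finite \<Rightarrow> int) measure"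
  assumes p: "1 \<le> p"
    and prob: "\<And>n. n \<ge> 1 \<Longrightarrow> prob_space (\<mu> n)"
    and space: "\<And>n. n \<ge> 1 \<Longrightarrow> space (\<mu> n) = configs n"
    and sets: "\<And>n. n \<ge> 1 \<Longrightarrow> sets (\<mu> n) = Pow (configs n)"
    and mixing: "\<And>n B C e\<^sub>B e\<^sub>C. n \<ge> 1 \<Longrightarrow> B \<subseteq> torus n \<Longrightarrow> C \<subseteq> torus n \<Longrightarrow> B \<inter> C = {} \<Longrightarrow>
      local_event n B e\<^sub>B \<Longrightarrow> local_event n C e\<^sub>C \<Longrightarrow>
      \<bar>measure (\<mu> n) (e\<^sub>B \<inter> e\<^sub>C) - measure (\<mu> n) e\<^sub>B * measure (\<mu> n) e\<^sub>C\<bar>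
        \<le> \<psi> (card B) (card C) * rate_at \<epsilon> (set_dist (torus_edges p \<rho> n) B C)"
    and \<epsilon>: "decseq \<epsilon>" "\<epsilon> \<longlonglongrightarrow> 0"
    and q: "0 < q" "\<And>n x. n \<ge> 1 \<Longrightarrow> real n > 2 * \<rho> * real T \<Longrightarrow> x \<in> torus n \<Longrightarrow>
      q \<le> measure (\<mu> n) (pattern_event p \<rho> n T \<zeta> x)"
  shows "(\<lambda>n. measure (\<mu> n) {\<eta> \<in> configs n. \<not> scattered p \<rho> T m n \<zeta> \<eta>}) \<longlonglongrightarrow> 0"
proof (rule tendstoI)
  fix \<delta> :: real assume \<delta>: "\<delta> > 0"
  define q' where "q' = min q 1"
  \<comment> \<open>Each of the \<open>m\<close> groups will contribute at most
    \<open>2 * \<delta>'\<close>; the denominator with \<open>m + 1\<close> makes the total strictly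
    less than \<open>\<delta>\<close>, also for \<open>m = 0\<close>.\<close>
  define \<delta>' where "\<delta>' = \<delta> / (2 * (m + 1))"
  have \<delta>': "\<delta>' > 0" using \<delta> by (simp add: \<delta>'_def)
  obtain k where k: "(1 - q') ^ k < \<delta>'"
    using real_arch_pow_inv[OF \<delta>', of "1 - q'"] q(1) by (auto simp: q'_def)
  let ?b = "card (lattice_ball p \<rho> T :: (int ^ 'd) set)"
  \<comment> \<open>Dominates \<open>\<psi>\<close> at the finitely many pairs of sizes of a ball
    and a union of at most \<open>k\<close> balls.\<close>
  define \<Psi> where "\<Psi> = (\<Sum>(a, c)\<in>{..?b} \<times> {..k * ?b}. \<bar>\<psi> a c\<bar>)"
  have \<Psi>0: "0 \<le> \<Psi>" unfolding \<Psi>_def by (intro sum_nonneg) auto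
  have \<Psi>: "\<psi> a c \<le> \<Psi>" if "a \<le> ?b" "c \<le> k * ?b" for a c
  proof -
    have "(case (a, c) of (a, c) \<Rightarrow> \<bar>\<psi> a c\<bar>) \<le> \<Psi>"
      unfolding \<Psi>_def by (rule member_le_sum) (use that in auto)
    then show ?thesis by simp
  qed
  have "(\<lambda>L. k * \<Psi> * \<epsilon> L) \<longlonglongrightarrow> k * \<Psi> * 0" by (intro tendsto_intros \<epsilon>(2))
  then have "\<forall>\<^sub>F L in sequentially. k * \<Psi> * \<epsilon> L < \<delta>'" using \<delta>' by (intro order_tendstoD(2)) auto
  then obtain L where L: "k * \<Psi> * \<epsilon> L < \<delta>'" by (auto simp: eventually_sequentially)
  have "\<forall>\<^sub>F n in sequentially. real n > 2 * \<rho> * real T"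
    by (rule eventually_nat_real)
  then show "\<forall>\<^sub>F n in sequentially. dist (measure (\<mu> n) {\<eta> \<in> configs n. \<not> scattered p \<rho> T m n \<zeta> \<eta>}) 0 < \<delta>"
    using eventually_ge_at_top[of 1] separated_points_exist[OF p, where N = "m * k" and L = "2 * T + L" and \<rho> = \<rho> and 'd = 'd]
  proof eventually_elim
    case (elim n)
    then obtain x :: "nat \<Rightarrow> int ^ 'd" where x: "\<And>i. i < m * k \<Longrightarrow> x i \<in> torus n"
      and sep: "\<And>i j z. i < m * k \<Longrightarrow> j < m * k \<Longrightarrow> i \<noteq> j \<Longrightarrow> z \<in> lattice_ball p \<rho> (2 * T + L) \<Longrightarrow>
        x j \<noteq> wrap n (x i + z)" by blast
    interpret prob_space "\<mu> n" using elim prob by simp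
    \<comment> \<open>Group \<open>i\<close> consists of the \<open>k\<close> centres with indices
      from \<open>i * k\<close> on.\<close>
    define bad where "bad i = {\<eta> \<in> configs n. \<forall>j<k. \<eta> \<notin> pattern_event p \<rho> n T \<zeta> (x (i * k + j))}" for i
    have events: "bad i \<in> events" for i using sets elim by (auto simp: bad_def)
    have index: "i * k + j < m * k" if "i < m" "j < k" for i j
    proof -
      have "i * k + j < (i + 1) * k" using that by simp
      also have "\<dots> \<le> m * k" using that by (intro mult_le_mono1) simp
      finally show ?thesis .
    qed
    have bad: "measure (\<mu> n) (bad i) \<le> 2 * \<delta>'" if i: "i < m" for i
    proof -
      have "measure (\<mu> n) (bad i) \<le> (1 - q') ^ k + k * \<Psi> * \<epsilon> L"
        unfolding bad_def
      proof (rule measure_avoid_patterns_le[where K = k and \<psi> = \<psi> and \<rho> = \<rho> and p = p])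
        show "q' \<le> measure (\<mu> n) (pattern_event p \<rho> n T \<zeta> v)" if "v \<in> torus n" for v
          using q(2)[OF _ _ that] elim by (simp add: q'_def min.coboundedI1)
        show "x (i * k + j') \<noteq> wrap n (x (i * k + j) + z)"
          if "j < k" "j' < k" "j \<noteq> j'" "z \<in> lattice_ball p \<rho> (2 * T + L)" for j j' z
          using that index[OF i] by (intro sep) auto
      qed (use p elim prob space sets mixing[of n] \<epsilon> q(1) \<Psi>0 \<Psi> x index[OF i] in \<open>auto simp: q'_def\<close>)
      with k L show ?thesis by simp
    qed
    have "{\<eta> \<in> configs n. \<not> scattered p \<rho> T m n \<zeta> \<eta>} \<subseteq> (\<Union>i<m. bad i)"
    proof (rule ccontr)
      assume "\<not> ?thesis"
      then obtain \<eta> where \<eta>: "\<eta> \<in> configs n" "\<not> scattered p \<rho> T m n \<zeta> \<eta>" "\<eta> \<notin> (\<Union>i<m. bad i)" by blast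
      then have "\<forall>i\<in>{..<m}. \<exists>j<k. \<eta> \<in> pattern_event p \<rho> n T \<zeta> (x (i * k + j))"
        by (auto simp: bad_def)
      then obtain f where f: "f i < k" "\<eta> \<in> pattern_event p \<rho> n T \<zeta> (x (i * k + f i))" if "i < m" for i
        by (metis lessThan_iff)
      have ne: "i * k + f i \<noteq> j * k + f j" if "i < m" "j < m" "i \<noteq> j" for i j
      proof
        assume "i * k + f i = j * k + f j"
        \<comment> \<open>Since \<open>f i < k\<close>, division by \<open>k\<close> recovers the
          number of the group.\<close>
        then have "(i * k + f i) div k = (j * k + f j) div k" by simp
        with f(1)[OF that(1)] f(1)[OF that(2)] that(3) show False by simp
      qed
      have "x (j * k + f j) \<noteq> wrap n (x (i * k + f i) + z)"
        if "i < m" "j < m" "i \<noteq> j" "z \<in> lattice_ball p \<rho> (2 * T)" for i j z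
        using that ne index f(1) subsetD[OF lattice_ball_mono[of "2 * T" "2 * T + L"] that(4)]
        by (intro sep) auto
      then have "scattered p \<rho> T m n \<zeta> \<eta>"
        unfolding scattered_def using f x index by (intro exI[of _ "\<lambda>i. x (i * k + f i)"]) auto
      with \<eta>(2) show False by contradiction
    qed
    then have "measure (\<mu> n) {\<eta> \<in> configs n. \<not> scattered p \<rho> T m n \<zeta> \<eta>} \<le> measure (\<mu> n) (\<Union>i<m. bad i)"
      using events by (intro finite_measure_mono) auto
    also have "\<dots> \<le> (\<Sum>i<m. measure (\<mu> n) (bad i))"
      using events by (intro finite_measure_subadditive_finite) auto
    also have "\<dots> \<le> (\<Sum>i<m. 2 * \<delta>')" using bad by (intro sum_mono) auto
    also have "\<dots> < \<delta>" using \<delta> by (simp add: \<delta>'_def field_simps)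
    finally show ?case by simp
  qed
qed

section \<open>Passage to the limit\<close>

lemma finite_local_configs: "1 \<le> p \<Longrightarrow> finite (local_configs p \<rho> r :: (int ^ 'd::finite \<Rightarrow> int) set)"
  unfolding local_configs_def by (intro finite_PiE finite_lattice_ball) auto

theorem theorem3p1:
  fixes p :: ennreal and \<rho> :: real
    and \<mu> :: "nat \<Rightarrow> (int ^ 'd::finite \<Rightarrow> int) measure"
    and S :: "'r \<Rightarrow> (int ^ 'd) set"
    and A :: "'r formula"
  assumes p: "1 \<le> p"
    and prob: "\<And>n. n \<ge> 1 \<Longrightarrow> prob_space (\<mu> n)"
    and space: "\<And>n. n \<ge> 1 \<Longrightarrow> space (\<mu> n) = configs n"
    and sets: "\<And>n. n \<ge> 1 \<Longrightarrow> sets (\<mu> n) = Pow (configs n)"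
    and graph: "\<And>n. n \<ge> 1 \<Longrightarrow> associated_graph (torus n) (torus_relation n S) = torus_edges p \<rho> n"
    and local_positivity: "\<forall>r. \<forall>\<zeta>\<in>local_configs p \<rho> r. \<exists>p\<^sub>D>0. \<forall>n\<ge>1. real n > 2 * \<rho> * real r \<longrightarrow>
           (\<forall>x\<in>torus n. measure (\<mu> n) (pattern_event p \<rho> n r \<zeta> x) \<ge> p\<^sub>D)"
    and mixing: "\<exists>(\<psi> :: nat \<Rightarrow> nat \<Rightarrow> real) \<epsilon>. decseq \<epsilon> \<and> \<epsilon> \<longlonglongrightarrow> 0 \<and>
           (\<forall>n\<ge>1. \<forall>B C e\<^sub>B e\<^sub>C. B \<subseteq> torus n \<longrightarrow> C \<subseteq> torus n \<longrightarrow> B \<inter> C = {} \<longrightarrow>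
              local_event n B e\<^sub>B \<longrightarrow> local_event n C e\<^sub>C \<longrightarrow>
              \<bar>measure (\<mu> n) (e\<^sub>B \<inter> e\<^sub>C) - measure (\<mu> n) e\<^sub>B * measure (\<mu> n) e\<^sub>C\<bar>
                \<le> \<psi> (card B) (card C) * rate_at \<epsilon> (set_dist (torus_edges p \<rho> n) B C))"
    and sentence: "sentence A"
  shows "(\<lambda>n. measure (\<mu> n) {\<eta> \<in> configs n. models n (torus_relation n S) \<eta> A}) \<longlonglongrightarrow> 0 \<or>
         (\<lambda>n. measure (\<mu> n) {\<eta> \<in> configs n. models n (torus_relation n S) \<eta> A}) \<longlonglongrightarrow> 1"
proof -
  define T where "T = locality_radius A"
  \<comment> \<open>One more than the bound on the number of old points, as the pigeonhole argument
    in \<open>rich_avoids\<close> needs strictly more places than points.\<close>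
  define m where "m = Suc (occurrences A)"
  let ?P = "\<lambda>n. measure (\<mu> n) {\<eta> \<in> configs n. models n (torus_relation n S) \<eta> A}"
  let ?bad = "\<lambda>n. measure (\<mu> n) {\<eta> \<in> configs n. \<not> rich p \<rho> T m n \<eta>}"
  obtain \<psi> :: "nat \<Rightarrow> nat \<Rightarrow> real" and \<epsilon> where \<epsilon>: "decseq \<epsilon>" "\<epsilon> \<longlonglongrightarrow> 0"
    and mix: "\<forall>n\<ge>1. \<forall>B C e\<^sub>B e\<^sub>C. B \<subseteq> torus n \<longrightarrow> C \<subseteq> torus n \<longrightarrow> B \<inter> C = {} \<longrightarrow>
      local_event n B e\<^sub>B \<longrightarrow> local_event n C e\<^sub>C \<longrightarrow>
      \<bar>measure (\<mu> n) (e\<^sub>B \<inter> e\<^sub>C) - measure (\<mu> n) e\<^sub>B * measure (\<mu> n) e\<^sub>C\<bar>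
        \<le> \<psi> (card B) (card C) * rate_at \<epsilon> (set_dist (torus_edges p \<rho> n) B C)"
    using mixing by (elim exE conjE) (rule that)
  have scattered: "(\<lambda>n. measure (\<mu> n) {\<eta> \<in> configs n. \<not> scattered p \<rho> T m n \<zeta> \<eta>}) \<longlonglongrightarrow> 0"
    if \<zeta>: "\<zeta> \<in> local_configs p \<rho> T" for \<zeta>
  proof -
    obtain q where q: "q > 0" "\<forall>n\<ge>1. real n > 2 * \<rho> * real T \<longrightarrow>
        (\<forall>x\<in>torus n. q \<le> measure (\<mu> n) (pattern_event p \<rho> n T \<zeta> x))"
      using local_positivity[rule_format, OF \<zeta>] by (elim exE conjE) (rule that)
    show ?thesis
      by (rule not_scattered_tendsto_0[OF p prob space sets mix[rule_format] \<epsilon> q(1)])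
        (use q(2) in auto)
  qed
  have fin: "finite (local_configs p \<rho> T :: (int ^ 'd \<Rightarrow> int) set)" by (rule finite_local_configs[OF p])
  \<comment> \<open>There are only finitely many local configurations of radius \<open>T\<close>, so
    a union bound turns the estimate for each of them into one for richness.\<close>
  have bad: "?bad \<longlonglongrightarrow> 0"
  proof (rule tendsto_sandwich[OF _ _ tendsto_const])
    let ?sum = "\<lambda>n. \<Sum>\<zeta>\<in>local_configs p \<rho> T.
      measure (\<mu> n) {\<eta> \<in> configs n. \<not> scattered p \<rho> T m n \<zeta> \<eta>}"
    show "?sum \<longlonglongrightarrow> 0" using tendsto_sum[OF scattered] by simp
    show "\<forall>\<^sub>F n in sequentially. ?bad n \<le> ?sum n"
      using eventually_ge_at_top[of 1]
    proof eventually_elim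
      case (elim n)
      interpret prob_space "\<mu> n" using elim prob by simp
      have "{\<eta> \<in> configs n. \<not> rich p \<rho> T m n \<eta>} =
        (\<Union>\<zeta>\<in>local_configs p \<rho> T. {\<eta> \<in> configs n. \<not> scattered p \<rho> T m n \<zeta> (\<eta> :: int ^ 'd \<Rightarrow> int)})"
        by (auto simp: rich_def)
      moreover have "measure (\<mu> n) (\<Union>\<zeta>\<in>local_configs p \<rho> T. {\<eta> \<in> configs n. \<not> scattered p \<rho> T m n \<zeta> \<eta>}) \<le> ?sum n"
        using sets[OF elim] fin by (intro finite_measure_subadditive_finite) auto
      ultimately show ?case by simp
    qed
  qed simp
  have disp: "S R \<subseteq> lattice_ball p \<rho> 1" for R by (rule displacement_in_lattice_ball[OF p graph])
  obtain N where N: "real n > 2 * \<rho> * real T" "n \<ge> 1" if "n \<ge> N" for n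
    using eventually_conj[OF eventually_nat_real[of "2 * \<rho> * real T"] eventually_ge_at_top[of 1]]
    by (auto simp: eventually_sequentially)
  have agree: "models n (torus_relation n S) \<eta> A \<longleftrightarrow> models n' (torus_relation n' S) \<eta>' A"
    if "n \<ge> N" "n' \<ge> N" "\<eta> \<in> configs n" "\<eta>' \<in> configs n'" "rich p \<rho> T m n \<eta>" "rich p \<rho> T m n' \<eta>'"
    for n n' \<eta> \<eta>'
    using that N[of n] N[of n']
    by (intro models_iff_if_rich[OF p disp sentence, of T m]) (auto simp: T_def m_def)
  show ?thesis
  \<comment> \<open>By \<open>agree\<close>, a single rich configuration satisfying \<open>A\<close>
    on some torus with \<open>n \<ge> N\<close> forces \<open>A\<close> in all rich ones, and then
    \<open>?P n\<close> is at least \<open>1 - ?bad n\<close>. Otherwise \<open>A\<close> holds only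
    in configurations that are not rich, and \<open>?P n\<close> is at most
    \<open>?bad n\<close>.\<close>
  proof (cases "\<exists>n\<ge>N. \<exists>\<eta>\<in>configs n. rich p \<rho> T m n \<eta> \<and> models n (torus_relation n S) \<eta> A")
    case True
    then have A: "models n (torus_relation n S) \<eta> A"
      if "n \<ge> N" "\<eta> \<in> configs n" "rich p \<rho> T m n \<eta>" for n \<eta>
      using agree that by blast
    have "?P \<longlonglongrightarrow> 1"
    proof (rule tendsto_sandwich[OF _ _ _ tendsto_const])
      show "(\<lambda>n. 1 - ?bad n) \<longlonglongrightarrow> 1" using tendsto_diff[OF tendsto_const bad, of 1] by simp
      show "\<forall>\<^sub>F n in sequentially. 1 - ?bad n \<le> ?P n" using eventually_ge_at_top[of N]
      proof eventually_elim
        case (elim n)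
        interpret prob_space "\<mu> n" using N[OF elim] prob by simp
        have "1 - ?bad n = prob (configs n - {\<eta> \<in> configs n. \<not> rich p \<rho> T m n \<eta>})"
          using N[OF elim] space sets prob_compl[of "{\<eta> \<in> configs n. \<not> rich p \<rho> T m n \<eta>}"] by auto
        also have "\<dots> \<le> ?P n"
          using A[OF elim] N[OF elim] sets by (intro finite_measure_mono) auto
        finally show ?case .
      qed
      show "\<forall>\<^sub>F n in sequentially. ?P n \<le> 1" using eventually_ge_at_top[of 1]
        by eventually_elim (use prob prob_space.prob_le_1 in blast)
    qed
    then show ?thesis ..
  next
    case False
    have "?P \<longlonglongrightarrow> 0"
    proof (rule tendsto_sandwich[OF _ _ tendsto_const bad])
      show "\<forall>\<^sub>F n in sequentially. ?P n \<le> ?bad n" using eventually_ge_at_top[of N]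
      proof eventually_elim
        case (elim n)
        interpret prob_space "\<mu> n" using N[OF elim] prob by simp
        show ?case using False elim N[OF elim] sets by (intro finite_measure_mono) auto
      qed
    qed simp
    then show ?thesis ..
  qed
qed

end
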